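(* Let $R$ be a Gorenstein local (or graded) ring with infinite residue field and $\frac12\in R$, let $\mathbb A$ be the minimal free resolution of a perfect $R$-module $M$, of format $(2,r_1,r_2,r_3)$ equal to $(2,6,5,1)$ or $(2,5,5,2)$, and let $\mathbb D$ be the free resolution of a module $M'$ minimally BR-linked to $M$ by means of the first four columns of $a_1$ (with the bases of $D_1,D_2,D_3$ given in the context). Let $\varepsilon=e_1\wedge e_2\wedge e_3\wedge e_4$. The maps $w^{(3)}_1:\bigwedge^3D_1\to D_2$ and $w^{(1)}_1:\bigwedge^4D_1\to D_0\otimes D_3$ of $\mathbb D$ are described as follows (left-hand sides are maps of $\mathbb D$, right-hand sides are maps of $\mathbb A$): $$w^{(3)}_1(s_1\wedge s_2\wedge\gamma_1)=\sum_{h=1}^{r_2}\langle w^{(2)}_1(e_1\wedge e_2\otimes f_h),\gamma_1\rangle\,\phi_h,$$ $$w^{(3)}_1(s_1\wedge\gamma_1\wedge\gamma_2)=\sum_{h=1}^{r_2}\langle w^{(2)}_{2,1}(\varepsilon\otimes e_1\otimes f_h),\gamma_1\wedge\gamma_2\rangle\,\phi_h,$$ $$w^{(1)}_1(s_1\wedge s_2\wedge s_3\wedge\gamma_1)=\sum_{j=1}^2\sum_{k=5}^{r_1}\langle w^{(1)}_1(e_1\wedge e_2\wedge e_3\wedge e_k),\gamma_1\otimes u_j^*\rangle\,(\epsilon_k\otimes u_j),$$ $$w^{(1)}_1(s_1\wedge s_2\wedge\gamma_1\wedge\gamma_2)=\sum_{j=1}^2\sum_{k=5}^{r_1}\langle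 w^{(1)}_{2,1}(\varepsilon\wedge e_k\otimes e_1\wedge e_2),\gamma_1\wedge\gamma_2\otimes u_j^*\rangle\,(\epsilon_k\otimes u_j).$$ Analogous formulas hold for all possible combinations of basis elements $\gamma_t$ and $s_j$. (The formulas involving $\gamma_2$ concern the case $r_3=2$.)
   Context: A module is perfect if its projective dimension equals the grade of its annihilator. The format of $0\to F_3\to F_2\to F_1\to F_0$ is the sequence of ranks $(r_0,r_1,r_2,r_3)$. Structure maps. Let $\mathbb F:0\to F_3\xrightarrow{d_3}F_2\xrightarrow{d_2}F_1\xrightarrow{d_1}F_0$ be a free resolution, $F_0=R^2$ with basis $u_1,u_2$; $e_i$, $f_h$ bases of $F_1$, $F_2$. $m_{ij}$ is the $2\times2$ minor of $d_1$ on columns $i,j$ ($m_{ji}=-m_{ij}$). Identify $\bigwedge^2F_0=R$ by $u_1\wedge u_2=1$, and for $v\in F_0$, $c=\sum_ju_j\otimes g_j\in F_0\otimes F_3$ put $v\wedge c=\sum_j(v\wedge u_j)g_j\in F_3$. The maps are obtained by lifting the indicated elements; when a lift is not unique some choice is fixed. Formulas are written for one choice of indices; the other entries are defined analogously, respecting skew-symmetry. Write $e_ie_je_k:=w^{(3)}_1(e_i\wedge e_j\wedge e_k)$, $\varepsilon_{1,\dots,i}=e_1\wedge\dots\wedge e_i$, hats denoting omission; tensor factors are reordered freely. - $w^{(3)}_1:\bigwedge^3F_1\to F_2$: $d_2(e_ie_je_k)=m_{ij}e_k-m_{ik}e_j+m_{jk}e_i$. - $w^{(2)}_1:\bigwedge^2F_1\otimes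 F_2\to F_3$: $d_3w^{(2)}_1(e_i\wedge e_j\otimes f_h)=m_{ij}f_h-w^{(3)}_1(d_2(f_h)\wedge e_i\wedge e_j)$. - $w^{(1)}_1:\bigwedge^4F_1\to F_0\otimes F_3$: $(1\otimes d_3)w^{(1)}_1(\varepsilon_{1,2,3,4})=\sum_{j=1}^4(-1)^{j+1}d_1(e_j)\otimes w^{(3)}_1(\varepsilon_{1,\dots,\hat j,\dots,4})$. - $w^{(3)}_{2,1}:\bigwedge^5F_1\otimes F_1\to F_2\otimes F_3$: $w^{(3)}_{2,1}(\varepsilon_{1,\dots,5}\otimes e_1)$ lifts $e_1e_2e_3\otimes e_1e_4e_5-e_1e_2e_4\otimes e_1e_3e_5+e_1e_2e_5\otimes e_1e_3e_4$, seen in $S_2F_2$, along the map $F_3\otimes F_2\to S_2F_2$ induced by $d_3$. - Let $\iota:\bigwedge^2F_3\to F_3\otimes F_2$, $\iota(a\wedge b)=d_3(a)\otimes b-a\otimes d_3(b)$. - $w^{(2)}_{2,1}:\bigwedge^4F_1\otimes F_1\otimes F_2\to\bigwedge^2F_3$ (needed here only when the factor in $F_1$ occurs in the factor in $\bigwedge^4F_1$): $w^{(2)}_{2,1}(\varepsilon_{1,2,3,4}\otimes e_1\otimes f_h)$ lifts along $\iota$ the element $e_1e_2e_3\otimes w^{(2)}_1(e_1\wedge e_4\otimes f_h)-e_1e_2e_4\otimes w^{(2)}_1(e_1\wedge e_3\otimes f_h)+e_1e_3e_4\otimes w^{(2)}_1(e_1\wedge e_2\otimes f_h)+f_h\otimes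 d_1(e_1)\wedge w^{(1)}_1(\varepsilon_{1,2,3,4})-w^{(3)}_{2,1}(\varepsilon_{1,2,3,4}\wedge d_2(f_h)\otimes e_1)$. - (when $r_1=5$) $w^{(1)}_{2,1}:\bigwedge^5F_1\otimes\bigwedge^2F_1\to F_0\otimes\bigwedge^2F_3$: $w^{(1)}_{2,1}(\varepsilon_{1,\dots,5}\otimes e_1\wedge e_2)$ lifts along $\iota\otimes\mathrm{id}_{F_0}$ the element $\sum_{i=3}^5(-1)^{i+1}e_1e_2e_i\otimes w^{(1)}_1(\varepsilon_{1,\dots,\hat i,\dots,5})+\sum_{j=1}^2(-1)^jd_1(e_j)\otimes w^{(3)}_{2,1}(\varepsilon_{1,\dots,5}\otimes e_{3-j})$. The linked complex. Let $\mathbb A:0\to A_3\xrightarrow{a_3}A_2\xrightarrow{a_2}A_1\xrightarrow{a_1}A_0$ have bases $\{e_k\}$ of $A_1$, $\{f_h\}$ of $A_2$, $\{g_t\}$ of $A_3$, dual bases $\{\epsilon_k\},\{\phi_h\},\{\gamma_t\}$ of $A_1^*,A_2^*,A_3^*$; $\langle\cdot,\cdot\rangle$ is evaluation. Let $x_{ij},y_{ij},z_{ij}$ be the entries of the matrices of $a_1,a_2,a_3$. Assume the ideal of $2\times2$ minors of the first four columns of $a_1$ has height 3. Let $\{s_1,\dots,s_4\}$ be a basis of $B_1=R^4$, $b_1(s_i)=a_1(e_i)$, and let $\mathbb B$ be the Buchsbaum--Rim complex resolving $\operatorname{coker}b_1$, with basis $\{t_1,\dots,t_4\}$ of $B_2$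 and differential $b_2:B_2\to B_1$. The minimally BR-linked module $M'$ is the one resolved by $\mathbb D:0\to A_1^*\xrightarrow{d_3}A_2^*\oplus B_2\xrightarrow{d_2}A_3^*\oplus B_1\xrightarrow{d_1}D_0=A_0$, the mapping cone of the map $\mathbb A^*\to\mathbb B$, with components $\beta_i:A_i^*\to B_{3-i}$, dual (via the self-duality of $\mathbb B$) to the comparison map $\mathbb B\to\mathbb A$ lifting the identity of $A_0$ and sending $s_i\mapsto e_i$. Its differentials are $$d_1=\begin{bmatrix}\beta_3&b_1\end{bmatrix},\quad d_2=\begin{bmatrix}a_3^*&0\\-\beta_2&-b_2\end{bmatrix},\quad d_3=\begin{bmatrix}a_2^*\\\beta_1\end{bmatrix},$$ where $\beta_1(\epsilon_k)=t_k$ for $k\le4$ and $0$ otherwise; $\beta_2(\phi_h)=\langle e_2e_3e_4,\phi_h\rangle s_1-\langle e_1e_3e_4,\phi_h\rangle s_2+\langle e_1e_2e_4,\phi_h\rangle s_3-\langle e_1e_2e_3,\phi_h\rangle s_4$; $\beta_3(\gamma_t)=\sum_{j=1}^2\langle w^{(1)}_1(\varepsilon),\gamma_t\otimes u_j^*\rangle u_j$. The elements $\epsilon_1,\dots,\epsilon_4$ are redundant and are removed, with $t_j=\sum_hy_{jh}\phi_h$; after this, $D_1,D_2,D_3$ have bases $\{\gamma_1,\dots,\gamma_{r_3},s_1,\dots,s_4\}$, $\{\phi_1,\dots,\phi_{r_2}\}$, $\{\epsilon_5,\dots,\epsilon_{r_1}\}$. The entries $w^{(3)}_1(s_i\wedge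 s_j\wedge s_k)$ and $w^{(1)}_1(s_1\wedge s_2\wedge s_3\wedge s_4)$ of $\mathbb D$, not listed in the claim, are obtained from those of $\mathbb B$; for $i<j<k$ and $\{i,j,k,r\}=\{1,2,3,4\}$, $w^{(3)}_1(s_i\wedge s_j\wedge s_k)=(-1)^rt_r$.
   Formalization: In w^{(2)}_{2,1} the term w^{(3)}_{2,1} is added, not subtracted (else no lift exists); in D, γ_t and φ_h are the negatives of the dual bases in the printed cone: d_1=[-β_3 b_1], d_2=[a_3^*; β_2], d_3=-a_2^* (else formulas 2 and 3 fail by a sign). *)

theory Defs
  imports
    "Jordan_Normal_Form.Matrix_Kernel"
    "HOL-Algebra.Ring_Divisibility"
    "HOL-Algebra.QuotRing"
    "HOL-Library.Extended_Nat"
begin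

section \<open>Commutative algebra\<close>

text \<open>
  The base ring is a type of class \<^class>\<open>comm_ring_1\<close>; \<^const>\<open>class_ring\<close> is the corresponding
  HOL-Algebra ring and \<^const>\<open>module_vec\<close> its free modules of finite rank.
\<close>

subsection \<open>Local and graded rings\<close>

definition ring_grading :: "(nat \<Rightarrow> 'a::comm_ring_1 set) \<Rightarrow> bool" where
  "ring_grading G \<longleftrightarrow>
     (\<forall>n. 0 \<in> G n \<and> (\<forall>x\<in>G n. \<forall>y\<in>G n. x - y \<in> G n)) \<and>
     (\<forall>i j. \<forall>x\<in>G i. \<forall>y\<in>G j. x * y \<in> G (i + j)) \<and>
     (\<forall>x. \<exists>!c. (\<forall>n. c n \<in> G n) \<and> finite {n. c n \<noteq> 0} \<and> x = (\<Sum>n | c n \<noteq> 0. c n))"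

definition homogeneous_ideal :: "(nat \<Rightarrow> 'a::comm_ring_1 set) \<Rightarrow> 'a set \<Rightarrow> bool" where
  "homogeneous_ideal G I \<longleftrightarrow>
     ideal I class_ring \<and>
     (\<forall>c. (\<forall>n. c n \<in> G n) \<and> finite {n. c n \<noteq> 0} \<and> (\<Sum>n | c n \<noteq> 0. c n) \<in> I \<longrightarrow> (\<forall>n. c n \<in> I))"

text \<open>
  A graded ring is non-negatively graded, with a largest proper homogeneous ideal \<open>m\<close>; its residue
  field is the quotient by \<open>m\<close> (which is then a maximal ideal). A local ring is the special case of a
  grading concentrated in degree 0, see \<open>graded_local_trivial\<close> below.
\<close>

definition graded_local :: "(nat \<Rightarrow> 'a::comm_ring_1 set) \<Rightarrow> 'a set \<Rightarrow> bool" where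
  "graded_local G m \<longleftrightarrow>
     ring_grading G \<and> homogeneous_ideal G m \<and> m \<noteq> UNIV \<and>
     (\<forall>I. homogeneous_ideal G I \<and> I \<noteq> UNIV \<longrightarrow> I \<subseteq> m)"

lemma graded_local_trivial:
  fixes m :: "'a::comm_ring_1 set"
  assumes m: "ideal m class_ring" "m \<noteq> UNIV"
    and max: "\<And>I. ideal I class_ring \<Longrightarrow> I \<noteq> UNIV \<Longrightarrow> I \<subseteq> m"
  shows "graded_local (\<lambda>n. if n = 0 then UNIV else {0}) m"
proof -
  let ?G = "\<lambda>n::nat. if n = 0 then UNIV else {0::'a}"
  have ex: "(\<Sum>n | c n \<noteq> 0. c n) = c 0" if "\<forall>n. c n \<in> ?G n" for c :: "nat \<Rightarrow> 'a"
  proof -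
    have z: "c n = 0" if "n \<noteq> 0" for n
      using spec[OF \<open>\<forall>n. c n \<in> ?G n\<close>, of n] that by simp
    have "(\<Sum>n | c n \<noteq> 0. c n) = (\<Sum>n\<in>{0}. c n)"
      by (rule sum.mono_neutral_left) (use z in auto)
    then show ?thesis by simp
  qed
  have "\<exists>!c. (\<forall>n. c n \<in> ?G n) \<and> finite {n. c n \<noteq> 0} \<and> x = (\<Sum>n | c n \<noteq> 0. c n)" for x :: 'a
  proof (rule ex1I[of _ "\<lambda>n. if n = 0 then x else 0"], intro conjI)
    let ?c = "\<lambda>n::nat. if n = 0 then x else 0"
    show mem: "\<forall>n. ?c n \<in> ?G n" by simp
    show "finite {n. ?c n \<noteq> 0}" by (rule finite_subset[of _ "{0}"]) auto
    show "x = (\<Sum>n | ?c n \<noteq> 0. ?c n)" using ex[OF mem] by simp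
  next
    fix c :: "nat \<Rightarrow> 'a"
    assume c: "(\<forall>n. c n \<in> ?G n) \<and> finite {n. c n \<noteq> 0} \<and> x = (\<Sum>n | c n \<noteq> 0. c n)"
    then have mem: "\<forall>n. c n \<in> ?G n" and x: "x = c 0"
      using ex[of c] by simp_all
    show "c = (\<lambda>n. if n = 0 then x else 0)"
    proof
      fix n
      show "c n = (if n = 0 then x else 0)"
        using spec[OF mem, of n] x by (cases "n = 0") simp_all
    qed
  qed
  then have "ring_grading ?G"
    unfolding ring_grading_def by (intro conjI allI) (auto split: if_splits)
  moreover have "homogeneous_ideal ?G I \<longleftrightarrow> ideal I class_ring" for I
  proof
    assume I: "ideal I class_ring"
    have 0: "0 \<in> I"
      using additive_subgroup.zero_closed[OF ideal.axioms(1)[OF I]] by (simp add: class_ring_simps)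
    have "c n \<in> I" if "\<forall>n. c n \<in> ?G n" "(\<Sum>n | c n \<noteq> 0. c n) \<in> I" for c :: "nat \<Rightarrow> 'a" and n
      using that(2) 0 ex[OF that(1)] spec[OF that(1), of n] by (cases "n = 0") auto
    then show "homogeneous_ideal ?G I"
      unfolding homogeneous_ideal_def using I by blast
  qed (simp add: homogeneous_ideal_def)
  ultimately show ?thesis
    unfolding graded_local_def using m max by blast
qed

subsection \<open>Gorenstein rings\<close>

definition regular_module :: "'a ring \<Rightarrow> ('a, 'a) module" where
  "regular_module R = ring.extend R \<lparr>smult = monoid.mult R\<rparr>"

text \<open>
  Injectivity is stated through Baer's criterion, because an extension property for all modules
  would have to quantify over carrier types.
\<close>

definition injective_module :: "'a ring \<Rightarrow> ('a, 'e) module \<Rightarrow> bool" where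
  "injective_module R E \<longleftrightarrow>
     Module.module R E \<and>
     (\<forall>I f. ideal I R \<and> f \<in> LinearCombinations.module_hom R ((regular_module R)\<lparr>carrier := I\<rparr>) E \<longrightarrow>
        (\<exists>g \<in> LinearCombinations.module_hom R (regular_module R) E. \<forall>x\<in>I. g x = f x))"

text \<open>
  The carrier type \<^typ>\<open>nat \<Rightarrow> 'a\<close> is no restriction: over a Noetherian ring the terms of the minimal
  injective resolution of \<open>R\<close> have at most \<open>max |R| \<aleph>\<^sub>0\<close> elements.
\<close>

definition finite_self_injective_dimension :: "'a ring \<Rightarrow> bool" where
  "finite_self_injective_dimension R \<longleftrightarrow>
     (\<exists>(n::nat) (E :: nat \<Rightarrow> ('a, nat \<Rightarrow> 'a) module) d \<eta>.
        (\<forall>i. injective_module R (E i)) \<and>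
        (\<forall>i>n. carrier (E i) = {\<zero>\<^bsub>E i\<^esub>}) \<and>
        \<eta> \<in> LinearCombinations.module_hom R (regular_module R) (E 0) \<and> inj_on \<eta> (carrier R) \<and>
        (\<forall>i. d i \<in> LinearCombinations.module_hom R (E i) (E (Suc i))) \<and>
        a_kernel (E 0) (E 1) (d 0) = \<eta> ` carrier R \<and>
        (\<forall>i. a_kernel (E (Suc i)) (E (Suc (Suc i))) (d (Suc i)) = d i ` carrier (E i)))"

text \<open>
  For Noetherian rings of finite Krull dimension (such as those with \<^const>\<open>graded_local\<close>), this is
  equivalent to all localizations having finite self-injective dimension.
\<close>

definition gorenstein_ring :: "'a ring \<Rightarrow> bool" where
  "gorenstein_ring R \<longleftrightarrow> cring R \<and> noetherian_ring R \<and> finite_self_injective_dimension R"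

subsection \<open>Height and grade of an ideal\<close>

definition prime_height :: "'a ring \<Rightarrow> 'a set \<Rightarrow> enat" where
  "prime_height R P = Sup {enat n | n. \<exists>p. (\<forall>i\<le>n. primeideal (p i) R) \<and>
                                          (\<forall>i<n. p i \<subset> p (Suc i)) \<and> p n = P}"

definition ideal_height :: "'a ring \<Rightarrow> 'a set \<Rightarrow> enat" where
  "ideal_height R I = Inf {prime_height R P | P. primeideal P R \<and> I \<subseteq> P}"

definition regular_sequence :: "'a ring \<Rightarrow> 'a list \<Rightarrow> bool" where
  "regular_sequence R xs \<longleftrightarrow>
     set xs \<subseteq> carrier R \<and> Idl\<^bsub>R\<^esub> (set xs) \<noteq> carrier R \<and>
     (\<forall>i<length xs. \<forall>r\<in>carrier R.
        xs ! i \<otimes>\<^bsub>R\<^esub> r \<in> Idl\<^bsub>R\<^esub> (set (take i xs)) \<longrightarrow> r \<in> Idl\<^bsub>R\<^esub> (set (take i xs)))"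

definition grade :: "'a ring \<Rightarrow> 'a set \<Rightarrow> enat" where
  "grade R I = Sup {enat (length xs) | xs. regular_sequence R xs \<and> set xs \<subseteq> I}"

subsection \<open>Perfect modules\<close>

definition fg_projective :: "('a::comm_ring_1, 'm) module \<Rightarrow> bool" where
  "fg_projective P \<longleftrightarrow>
     Module.module class_ring P \<and>
     (\<exists>n. \<exists>i \<in> LinearCombinations.module_hom class_ring P (module_vec TYPE('a) n).
          \<exists>p \<in> LinearCombinations.module_hom class_ring (module_vec TYPE('a) n) P. \<forall>x\<in>carrier P. p (i x) = x)"

text \<open>
  Only used for finitely generated modules over Noetherian rings, where projective resolutions can
  be taken with finitely generated terms, i.e. up to isomorphism with submodules of free modules
  of finite rank.
\<close>

definition projective_dimension :: "('a::comm_ring_1, 'm) module \<Rightarrow> enat" where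
  "projective_dimension M = Inf {enat n | n.
     \<exists>(P :: nat \<Rightarrow> ('a, 'a vec) module) d \<eta>.
        (\<forall>i. fg_projective (P i)) \<and>
        (\<forall>i>n. carrier (P i) = {\<zero>\<^bsub>P i\<^esub>}) \<and>
        \<eta> \<in> LinearCombinations.module_hom class_ring (P 0) M \<and> \<eta> ` carrier (P 0) = carrier M \<and>
        (\<forall>i. d i \<in> LinearCombinations.module_hom class_ring (P (Suc i)) (P i)) \<and>
        a_kernel (P 0) M \<eta> = d 0 ` carrier (P 1) \<and>
        (\<forall>i. a_kernel (P (Suc i)) (P i) (d i) = d (Suc i) ` carrier (P (Suc (Suc i))))}"

definition annihilator :: "('a::comm_ring_1, 'm) module \<Rightarrow> 'a set" where
  "annihilator M = {r. \<forall>x\<in>carrier M. r \<odot>\<^bsub>M\<^esub> x = \<zero>\<^bsub>M\<^esub>}"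

definition perfect_module :: "('a::comm_ring_1, 'm) module \<Rightarrow> bool" where
  "perfect_module M \<longleftrightarrow>
     Module.module class_ring M \<and> projective_dimension M = grade class_ring (annihilator M)"

subsection \<open>Free resolutions of length three\<close>

definition mat_image :: "'a::comm_ring_1 mat \<Rightarrow> 'a vec set" where
  "mat_image A = (\<lambda>v. A *\<^sub>v v) ` carrier_vec (dim_col A)"

text \<open>\<open>\<eta>\<close> is the augmentation from the free module of rank \<open>r0\<close> to \<open>M\<close>.\<close>

definition free_resolution ::
  "nat \<times> nat \<times> nat \<times> nat \<Rightarrow> 'a::comm_ring_1 mat \<Rightarrow> 'a mat \<Rightarrow> 'a mat \<Rightarrow>
   ('a vec \<Rightarrow> 'm) \<Rightarrow> ('a, 'm) module \<Rightarrow> bool" where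
  "free_resolution = (\<lambda>(r0, r1, r2, r3) a1 a2 a3 \<eta> M.
     a1 \<in> carrier_mat r0 r1 \<and> a2 \<in> carrier_mat r1 r2 \<and> a3 \<in> carrier_mat r2 r3 \<and>
     Module.module class_ring M \<and>
     \<eta> \<in> LinearCombinations.module_hom class_ring (module_vec TYPE('a) r0) M \<and>
     \<eta> ` carrier_vec r0 = carrier M \<and>
     a_kernel (module_vec TYPE('a) r0) M \<eta> = mat_image a1 \<and>
     mat_kernel a1 = mat_image a2 \<and>
     mat_kernel a2 = mat_image a3 \<and>
     mat_kernel a3 = {0\<^sub>v r3})"

definition homogeneous_mat ::
  "(nat \<Rightarrow> 'a::comm_ring_1 set) \<Rightarrow> (nat \<Rightarrow> int) \<Rightarrow> (nat \<Rightarrow> int) \<Rightarrow> 'a mat \<Rightarrow> bool" where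
  "homogeneous_mat G rdeg cdeg A \<longleftrightarrow>
     (\<forall>i<dim_row A. \<forall>j<dim_col A.
        A $$ (i, j) \<in> (if cdeg j < rdeg i then {0} else G (nat (cdeg j - rdeg i))))"

text \<open>
  In the graded case the differentials are homogeneous for suitable degrees of the basis elements,
  and \<open>M\<close> carries the induced grading. For a grading concentrated in degree 0 all degrees can be
  taken to be 0, and the condition is void.
\<close>

definition minimal_free_resolution ::
  "(nat \<Rightarrow> 'a::comm_ring_1 set) \<Rightarrow> 'a set \<Rightarrow> nat \<times> nat \<times> nat \<times> nat \<Rightarrow>
   'a mat \<Rightarrow> 'a mat \<Rightarrow> 'a mat \<Rightarrow> ('a vec \<Rightarrow> 'm) \<Rightarrow> ('a, 'm) module \<Rightarrow> bool" where
  "minimal_free_resolution G m fmt a1 a2 a3 \<eta> M \<longleftrightarrow>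
     free_resolution fmt a1 a2 a3 \<eta> M \<and>
     elements_mat a1 \<union> elements_mat a2 \<union> elements_mat a3 \<subseteq> m \<and>
     (\<exists>deg0 deg1 deg2 deg3. homogeneous_mat G deg0 deg1 a1 \<and>
        homogeneous_mat G deg1 deg2 a2 \<and> homogeneous_mat G deg2 deg3 a3)"

section \<open>Structure maps\<close>

text \<open>
  Let \<open>d1\<close>, \<open>d2\<close>, \<open>d3\<close> be the matrices of a complex of free modules \<open>F\<^sub>3 \<rightarrow> F\<^sub>2 \<rightarrow> F\<^sub>1 \<rightarrow> F\<^sub>0\<close> with
  \<open>F\<^sub>0\<close> of rank 2. All indices of basis elements start at 0. A linear map on an exterior power of
  \<open>F\<^sub>1\<close> is given by its coordinates on the elements \<open>e\<^sub>i \<and> e\<^sub>j \<and> \<dots>\<close>, as an alternating function of the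
  list \<open>[i, j, \<dots>]\<close>:

    \<^item> \<open>w3 [i,j,k] h\<close> is the coefficient of \<open>f\<^sub>h\<close> in \<open>w\<^sup>(\<^sup>3\<^sup>)\<^sub>1(e\<^sub>i \<and> e\<^sub>j \<and> e\<^sub>k)\<close>;
    \<^item> \<open>w2 [i,j] h t\<close> is the coefficient of \<open>g\<^sub>t\<close> in \<open>w\<^sup>(\<^sup>2\<^sup>)\<^sub>1(e\<^sub>i \<and> e\<^sub>j \<otimes> f\<^sub>h)\<close>;
    \<^item> \<open>w1 [i,j,k,l] c t\<close> is the coefficient of \<open>u\<^sub>c \<otimes> g\<^sub>t\<close> in \<open>w\<^sup>(\<^sup>1\<^sup>)\<^sub>1(e\<^sub>i \<and> e\<^sub>j \<and> e\<^sub>k \<and> e\<^sub>l)\<close>;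
    \<^item> \<open>w321 [i,j,k,l,m] p h t\<close> is the coefficient of \<open>f\<^sub>h \<otimes> g\<^sub>t\<close> in
      \<open>w\<^sup>(\<^sup>3\<^sup>)\<^sub>2\<^sub>,\<^sub>1(e\<^sub>i \<and> e\<^sub>j \<and> e\<^sub>k \<and> e\<^sub>l \<and> e\<^sub>m \<otimes> e\<^sub>p)\<close>, for \<open>p\<close> among \<open>i,j,k,l,m\<close>;
    \<^item> \<open>w221 [i,j,k,l] p h t u\<close> is the coefficient of \<open>g\<^sub>t \<and> g\<^sub>u\<close> in
      \<open>w\<^sup>(\<^sup>2\<^sup>)\<^sub>2\<^sub>,\<^sub>1(e\<^sub>i \<and> e\<^sub>j \<and> e\<^sub>k \<and> e\<^sub>l \<otimes> e\<^sub>p \<otimes> f\<^sub>h)\<close>, for \<open>p\<close> among \<open>i,j,k,l\<close>;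
    \<^item> \<open>w121 [i,j,k,l,m] [p,q] c t u\<close> is the coefficient of \<open>u\<^sub>c \<otimes> (g\<^sub>t \<and> g\<^sub>u)\<close> in
      \<open>w\<^sup>(\<^sup>1\<^sup>)\<^sub>2\<^sub>,\<^sub>1(e\<^sub>i \<and> e\<^sub>j \<and> e\<^sub>k \<and> e\<^sub>l \<and> e\<^sub>m \<otimes> e\<^sub>p \<and> e\<^sub>q)\<close>.

  Here the coefficient of \<open>g\<^sub>t \<and> g\<^sub>u\<close> is its value under \<open>\<gamma>\<^sub>t \<and> \<gamma>\<^sub>u\<close>, a skew-symmetric function of
  \<open>(t, u)\<close>. Since the right-hand sides below are alternating too, each lifting condition holds for all
  indices as soon as it holds for distinct ones.
\<close>

definition alternating :: "nat \<Rightarrow> nat \<Rightarrow> (nat list \<Rightarrow> 'a::ab_group_add) \<Rightarrow> bool" where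
  "alternating n p w \<longleftrightarrow>
     (\<forall>xs. length xs = p \<and> set xs \<subseteq> {..<n} \<longrightarrow>
        (\<not> distinct xs \<longrightarrow> w xs = 0) \<and>
        (\<forall>i<p. \<forall>j<p. i \<noteq> j \<longrightarrow> w (xs[i := xs ! j, j := xs ! i]) = - w xs))"

definition skew :: "nat \<Rightarrow> (nat \<Rightarrow> nat \<Rightarrow> 'a::ab_group_add) \<Rightarrow> bool" where
  "skew n c \<longleftrightarrow> (\<forall>t<n. \<forall>u<n. c t t = 0 \<and> c u t = - c t u)"

text \<open>\<open>minor d i j\<close> is the \<open>2 \<times> 2\<close> minor on columns \<open>i\<close>, \<open>j\<close>, i.e. \<open>d(e\<^sub>i) \<and> d(e\<^sub>j)\<close> for \<open>u\<^sub>0 \<and> u\<^sub>1 = 1\<close>.\<close>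

definition minor :: "'a::comm_ring_1 mat \<Rightarrow> nat \<Rightarrow> nat \<Rightarrow> 'a" where
  "minor d i j = d $$ (0, i) * d $$ (1, j) - d $$ (0, j) * d $$ (1, i)"

definition is_w3_1 :: "'a::comm_ring_1 mat \<Rightarrow> 'a mat \<Rightarrow> (nat list \<Rightarrow> nat \<Rightarrow> 'a) \<Rightarrow> bool" where
  "is_w3_1 d1 d2 w3 \<longleftrightarrow>
     (let r1 = dim_col d1; r2 = dim_col d2 in
     (\<forall>h<r2. alternating r1 3 (\<lambda>xs. w3 xs h)) \<and>
     (\<forall>i<r1. \<forall>j<r1. \<forall>k<r1. \<forall>n<r1.
        (\<Sum>h<r2. d2 $$ (n, h) * w3 [i,j,k] h) =
          minor d1 i j * of_bool (n = k) - minor d1 i k * of_bool (n = j)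
          + minor d1 j k * of_bool (n = i)))"

definition is_w2_1 :: "'a::comm_ring_1 mat \<Rightarrow> 'a mat \<Rightarrow> 'a mat \<Rightarrow> (nat list \<Rightarrow> nat \<Rightarrow> 'a) \<Rightarrow>
    (nat list \<Rightarrow> nat \<Rightarrow> nat \<Rightarrow> 'a) \<Rightarrow> bool" where
  "is_w2_1 d1 d2 d3 w3 w2 \<longleftrightarrow>
     (let r1 = dim_col d1; r2 = dim_col d2; r3 = dim_col d3 in
     (\<forall>h<r2. \<forall>t<r3. alternating r1 2 (\<lambda>xs. w2 xs h t)) \<and>
     (\<forall>i<r1. \<forall>j<r1. \<forall>h<r2. \<forall>n<r2.
        (\<Sum>t<r3. d3 $$ (n, t) * w2 [i,j] h t) =
          minor d1 i j * of_bool (n = h) - (\<Sum>k<r1. d2 $$ (k, h) * w3 [k,i,j] n)))"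

definition is_w1_1 :: "'a::comm_ring_1 mat \<Rightarrow> 'a mat \<Rightarrow> (nat list \<Rightarrow> nat \<Rightarrow> 'a) \<Rightarrow>
    (nat list \<Rightarrow> nat \<Rightarrow> nat \<Rightarrow> 'a) \<Rightarrow> bool" where
  "is_w1_1 d1 d3 w3 w1 \<longleftrightarrow>
     (let r1 = dim_col d1; r2 = dim_row d3; r3 = dim_col d3 in
     (\<forall>c<2. \<forall>t<r3. alternating r1 4 (\<lambda>xs. w1 xs c t)) \<and>
     (\<forall>i<r1. \<forall>j<r1. \<forall>k<r1. \<forall>l<r1. \<forall>c<2. \<forall>n<r2.
        (\<Sum>t<r3. d3 $$ (n, t) * w1 [i,j,k,l] c t) =
          d1 $$ (c, i) * w3 [j,k,l] n - d1 $$ (c, j) * w3 [i,k,l] n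
          + d1 $$ (c, k) * w3 [i,j,l] n - d1 $$ (c, l) * w3 [i,j,k] n))"

text \<open>Equality in \<open>S\<^sub>2F\<close> (\<open>F\<close> of rank \<open>n\<close>) of the images of two elements of \<open>F \<otimes> F\<close>.\<close>

definition sym2_eq :: "nat \<Rightarrow> (nat \<Rightarrow> nat \<Rightarrow> 'a::ab_group_add) \<Rightarrow> (nat \<Rightarrow> nat \<Rightarrow> 'a) \<Rightarrow> bool" where
  "sym2_eq n x y \<longleftrightarrow>
     (\<forall>p<n. x p p = y p p) \<and> (\<forall>p<n. \<forall>q<n. p \<noteq> q \<longrightarrow> x p q + x q p = y p q + y q p)"

definition is_w3_21 :: "'a::comm_ring_1 mat \<Rightarrow> 'a mat \<Rightarrow> (nat list \<Rightarrow> nat \<Rightarrow> 'a) \<Rightarrow>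
    (nat list \<Rightarrow> nat \<Rightarrow> nat \<Rightarrow> nat \<Rightarrow> 'a) \<Rightarrow> bool" where
  "is_w3_21 d1 d3 w3 w321 \<longleftrightarrow>
     (let r1 = dim_col d1; r2 = dim_row d3; r3 = dim_col d3 in
     (\<forall>p<r1. \<forall>h<r2. \<forall>t<r3. alternating r1 5 (\<lambda>xs. w321 xs p h t)) \<and>
     (\<forall>i<r1. \<forall>j<r1. \<forall>k<r1. \<forall>l<r1. \<forall>m<r1.
        sym2_eq r2
          (\<lambda>x y. \<Sum>t<r3. d3 $$ (x, t) * w321 [i,j,k,l,m] i y t)
          (\<lambda>x y. w3 [i,j,k] x * w3 [i,l,m] y - w3 [i,j,l] x * w3 [i,k,m] y
                 + w3 [i,j,m] x * w3 [i,k,l] y)))"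

text \<open>
  For skew-symmetric \<open>c\<close>, the coefficient of \<open>f\<^sub>n \<otimes> g\<^sub>u\<close> in
  \<open>\<iota>(\<Sum>\<^sub>t\<^sub><\<^sub>u c t u \<cdot> g\<^sub>t \<and> g\<^sub>u)\<close>, where \<open>\<iota>(a \<and> b) = d\<^sub>3(a) \<otimes> b - a \<otimes> d\<^sub>3(b)\<close>.
\<close>

definition iota :: "'a::comm_ring_1 mat \<Rightarrow> (nat \<Rightarrow> nat \<Rightarrow> 'a) \<Rightarrow> nat \<Rightarrow> nat \<Rightarrow> 'a" where
  "iota d3 c n u = (\<Sum>t<dim_col d3. d3 $$ (n, t) * c t u)"

text \<open>
  The last term, involving \<open>w321\<close>, has to be added: modulo \<open>\<iota>\<close>, i.e. in \<open>S\<^sub>2F\<^sub>2\<close>, the other terms sum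
  up to \<open>-(e\<^sub>ie\<^sub>je\<^sub>k \<cdot> e\<^sub>ie\<^sub>lx - e\<^sub>ie\<^sub>je\<^sub>l \<cdot> e\<^sub>ie\<^sub>kx + e\<^sub>ie\<^sub>jx \<cdot> e\<^sub>ie\<^sub>ke\<^sub>l)\<close> with \<open>x = d\<^sub>2(f\<^sub>h)\<close>, which is the negative of
  what \<open>w321\<close> lifts; with the opposite sign there would be no lift.
\<close>

definition is_w2_21 :: "'a::comm_ring_1 mat \<Rightarrow> 'a mat \<Rightarrow> 'a mat \<Rightarrow> (nat list \<Rightarrow> nat \<Rightarrow> 'a) \<Rightarrow>
    (nat list \<Rightarrow> nat \<Rightarrow> nat \<Rightarrow> 'a) \<Rightarrow> (nat list \<Rightarrow> nat \<Rightarrow> nat \<Rightarrow> 'a) \<Rightarrow>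
    (nat list \<Rightarrow> nat \<Rightarrow> nat \<Rightarrow> nat \<Rightarrow> 'a) \<Rightarrow>
    (nat list \<Rightarrow> nat \<Rightarrow> nat \<Rightarrow> nat \<Rightarrow> nat \<Rightarrow> 'a) \<Rightarrow> bool" where
  "is_w2_21 d1 d2 d3 w3 w2 w1 w321 w221 \<longleftrightarrow>
     (let r1 = dim_col d1; r2 = dim_col d2; r3 = dim_col d3 in
     (\<forall>p<r1. \<forall>h<r2. \<forall>t<r3. \<forall>u<r3. alternating r1 4 (\<lambda>xs. w221 xs p h t u)) \<and>
     (\<forall>i<r1. \<forall>j<r1. \<forall>k<r1. \<forall>l<r1. \<forall>h<r2. skew r3 (w221 [i,j,k,l] i h)) \<and>
     (\<forall>i<r1. \<forall>j<r1. \<forall>k<r1. \<forall>l<r1. \<forall>h<r2. \<forall>n<r2. \<forall>u<r3.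
        iota d3 (w221 [i,j,k,l] i h) n u =
          w3 [i,j,k] n * w2 [i,l] h u - w3 [i,j,l] n * w2 [i,k] h u + w3 [i,k,l] n * w2 [i,j] h u
          + of_bool (n = h) * (d1 $$ (0, i) * w1 [i,j,k,l] 1 u - d1 $$ (1, i) * w1 [i,j,k,l] 0 u)
          + (\<Sum>x<r1. d2 $$ (x, h) * w321 [i,j,k,l,x] i n u)))"

definition is_w1_21 :: "'a::comm_ring_1 mat \<Rightarrow> 'a mat \<Rightarrow> (nat list \<Rightarrow> nat \<Rightarrow> 'a) \<Rightarrow>
    (nat list \<Rightarrow> nat \<Rightarrow> nat \<Rightarrow> 'a) \<Rightarrow> (nat list \<Rightarrow> nat \<Rightarrow> nat \<Rightarrow> nat \<Rightarrow> 'a) \<Rightarrow>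
    (nat list \<Rightarrow> nat list \<Rightarrow> nat \<Rightarrow> nat \<Rightarrow> nat \<Rightarrow> 'a) \<Rightarrow> bool" where
  "is_w1_21 d1 d3 w3 w1 w321 w121 \<longleftrightarrow>
     (let r1 = dim_col d1; r2 = dim_row d3; r3 = dim_col d3 in
     (\<forall>c<2. \<forall>t<r3. \<forall>u<r3. \<forall>p<r1. \<forall>q<r1. alternating r1 5 (\<lambda>xs. w121 xs [p,q] c t u)) \<and>
     (\<forall>i<r1. \<forall>j<r1. \<forall>k<r1. \<forall>l<r1. \<forall>m<r1. \<forall>c<2.
        (\<forall>t<r3. \<forall>u<r3. alternating r1 2 (\<lambda>ys. w121 [i,j,k,l,m] ys c t u)) \<and>
        (\<forall>p<r1. \<forall>q<r1. skew r3 (w121 [i,j,k,l,m] [p,q] c))) \<and>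
     (\<forall>i<r1. \<forall>j<r1. \<forall>k<r1. \<forall>l<r1. \<forall>m<r1. \<forall>c<2. \<forall>n<r2. \<forall>u<r3.
        iota d3 (w121 [i,j,k,l,m] [i,j] c) n u =
          w3 [i,j,k] n * w1 [i,j,l,m] c u - w3 [i,j,l] n * w1 [i,j,k,m] c u
          + w3 [i,j,m] n * w1 [i,j,k,l] c u
          - d1 $$ (c, i) * w321 [i,j,k,l,m] j n u + d1 $$ (c, j) * w321 [i,j,k,l,m] i n u))"

section \<open>The minimally BR-linked resolution\<close>

text \<open>
  The complex \<open>0 \<rightarrow> D\<^sub>3 \<rightarrow> D\<^sub>2 \<rightarrow> D\<^sub>1 \<rightarrow> D\<^sub>0\<close> obtained from the mapping cone of \<open>\<beta> : A\<^sup>* \<rightarrow> B\<close> by cancelling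
  \<open>\<epsilon>\<^sub>0,\<dots>,\<epsilon>\<^sub>3\<close> against \<open>t\<^sub>0,\<dots>,t\<^sub>3\<close> (which does not change the components of the differentials that
  remain). \<open>D\<^sub>1\<close> has the basis \<open>\<gamma>\<^sub>0,\<dots>,\<gamma>\<^sub>r\<^sub>3\<^sub>-\<^sub>1,s\<^sub>0,\<dots>,s\<^sub>3\<close> in this order, \<open>D\<^sub>2\<close> has the basis \<open>\<phi>\<^sub>h\<close>, and
  \<open>D\<^sub>3\<close> has the basis \<open>\<epsilon>\<^sub>4,\<dots>,\<epsilon>\<^sub>r\<^sub>1\<^sub>-\<^sub>1\<close>. The linked module is the cokernel of the first matrix.

  Signs: \<open>\<gamma>\<^sub>t \<in> D\<^sub>1\<close> and \<open>\<phi>\<^sub>h \<in> D\<^sub>2\<close> are the negatives of the dual basis elements in the summands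
  \<open>A\<^sub>3\<^sup>*\<close> and \<open>A\<^sub>2\<^sup>*\<close> of the cone with
  \<open>d\<^sub>1 = (\<beta>\<^sub>3 b\<^sub>1)\<close>, \<open>d\<^sub>2 = (a\<^sub>3\<^sup>* 0; -\<beta>\<^sub>2 -b\<^sub>2)\<close>, \<open>d\<^sub>3 = (a\<^sub>2\<^sup>*; \<beta>\<^sub>1)\<close>. In these bases
  \<open>d\<^sub>1(\<gamma>\<^sub>t) = -\<beta>\<^sub>3(\<gamma>\<^sub>t)\<close>, \<open>d\<^sub>2(\<phi>\<^sub>h) = a\<^sub>3\<^sup>*(\<phi>\<^sub>h) + \<beta>\<^sub>2(\<phi>\<^sub>h)\<close>, \<open>d\<^sub>3(\<epsilon>\<^sub>k) = -a\<^sub>2\<^sup>*(\<epsilon>\<^sub>k)\<close> for \<open>k \<ge> 4\<close>, and the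
  cancellation gives \<open>t\<^sub>j = \<Sum>\<^sub>h y\<^sub>j\<^sub>h \<phi>\<^sub>h\<close>; with the other choice of sign there would be a minus sign
  in the last identity.
\<close>

definition beta3 :: "(nat list \<Rightarrow> nat \<Rightarrow> nat \<Rightarrow> 'a::comm_ring_1) \<Rightarrow> nat \<Rightarrow> nat \<Rightarrow> 'a" where
  "beta3 w1 c t = w1 [0,1,2,3] c t"

definition beta2 :: "(nat list \<Rightarrow> nat \<Rightarrow> 'a::comm_ring_1) \<Rightarrow> nat \<Rightarrow> nat \<Rightarrow> 'a" where
  "beta2 w3 j h = [w3 [1,2,3] h, - w3 [0,2,3] h, w3 [0,1,3] h, - w3 [0,1,2] h] ! j"

definition linked_d1 :: "'a::comm_ring_1 mat \<Rightarrow> 'a mat \<Rightarrow> (nat list \<Rightarrow> nat \<Rightarrow> nat \<Rightarrow> 'a) \<Rightarrow> 'a mat" where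
  "linked_d1 a1 a3 w1 = (let r3 = dim_col a3 in
     mat 2 (r3 + 4) (\<lambda>(c, i). if i < r3 then - beta3 w1 c i else a1 $$ (c, i - r3)))"

definition linked_d2 :: "'a::comm_ring_1 mat \<Rightarrow> (nat list \<Rightarrow> nat \<Rightarrow> 'a) \<Rightarrow> 'a mat" where
  "linked_d2 a3 w3 = (let r2 = dim_row a3; r3 = dim_col a3 in
     mat (r3 + 4) r2 (\<lambda>(i, h). if i < r3 then a3 $$ (h, i) else beta2 w3 (i - r3) h))"

definition linked_d3 :: "'a::comm_ring_1 mat \<Rightarrow> 'a mat" where
  "linked_d3 a2 = mat (dim_col a2) (dim_row a2 - 4) (\<lambda>(h, k). - a2 $$ (k + 4, h))"

end

(*
  Each lifting condition for the maps of the linked complex becomes an identity between structure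
  maps of A with values in A_3 or in its exterior square. As a3 is injective, such an identity may be
  checked after composing with a3 (with iota in the second case), where the defining equations of the
  structure maps, a1 a2 = 0 and a2 a3 = 0 reduce it to lower identities and to Plucker relations
  among the minors of a1.
  The prescribed values are extended from strictly increasing lists of indices to alternating
  functions by the sign of the sorting permutation, and since both sides of a lifting condition are
  alternating, it suffices to verify it on increasing lists; as r3 <= 2, these contain at most two
  of the basis elements gamma_t.
*)

theory Submission
  imports Defs "HOL-Combinatorics.Permutations"
begin

subsection \<open>Alternating functions of lists\<close>

text \<open>The differentials of the linked complex are transposes of those of A bordered by
  structure maps, so a lifting condition there contracts an argument of a structure map of A with a
  vector. The rows of \<open>linked_d2\<close> are columns of \<open>a3\<close> and values of
  \<open>w3\<close> on triples from {0,1,2,3}; hence the F_2 argument of \<open>w2\<close> and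
  \<open>w221\<close> has to be contracted with both. \<open>linked_d3\<close> is a truncated
  transpose of \<open>a2\<close>; hence an F_1 argument of \<open>w1\<close> and \<open>w121\<close>
  has to be contracted with columns of \<open>a2\<close>, and the indices below 4 that are cut off
  need a separate account. For values in the exterior square it is enough to cancel
  \<open>a3\<close> in the slot \<open>t\<close> while \<open>u\<close> stays fixed. The obstacle is
  \<open>w321\<close>: it is known only through its image in the symmetric square, so its entries
  cannot be computed and its terms have to disappear. They do so in three ways: by a2 a3 = 0, by a
  repeated index, or by cancelling between the conditions for \<open>w121\<close> and
  \<open>w221\<close>.\<close>

lemma permute_list_transpose:
  assumes "i < length xs" "j < length xs"
  shows "permute_list (transpose i j) xs = xs[i := xs ! j, j := xs ! i]"
  by (rule nth_equalityI) (use assms in \<open>auto simp: permute_list_def transpose_def nth_list_update\<close>)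

lemma alternating_transpose:
  assumes "alternating n p w" "length xs = p" "set xs \<subseteq> {..<n}" "i < p" "j < p" "i \<noteq> j"
  shows "w (permute_list (transpose i j) xs) = - w xs"
  using assms by (auto simp: alternating_def permute_list_transpose)

lemma alternating_permute:
  fixes w :: "nat list \<Rightarrow> 'a::ring_1"
  assumes w: "alternating n p w" and xs: "length xs = p" "set xs \<subseteq> {..<n}" and "\<pi> permutes {..<p}"
  shows "w (permute_list \<pi> xs) = of_int (sign \<pi>) * w xs"
  \<comment> \<open>A transposition composed on the right acts on the positions of the list already
    permuted by \<pi>, which is again a list of the same shape. Hence the reversed induction
    rule.\<close>
  using finite_lessThan \<open>\<pi> permutes {..<p}\<close> xs
proof (induction arbitrary: xs rule: permutes_rev_induct)
  case id
  then show ?case by simp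
next
  case (swap a b \<pi>)
  let ?ys = "permute_list \<pi> xs"
  have ys: "length ?ys = p" "set ?ys \<subseteq> {..<n}"
    using swap by (auto simp: set_permute_list)
  have "permute_list (\<pi> \<circ> transpose a b) xs = permute_list (transpose a b) ?ys"
    by (rule permute_list_compose) (use swap in \<open>simp add: permutes_swap_id\<close>)
  then have "w (permute_list (\<pi> \<circ> transpose a b) xs) = (if a = b then w ?ys else - w ?ys)"
    using alternating_transpose[OF w ys] swap by simp
  moreover have "permutation \<pi>"
    using swap permutation_permutes by blast
  then have "sign (\<pi> \<circ> transpose a b) = - sign \<pi>"
    using swap by (subst sign_compose) (simp_all add: permutation_swap_id sign_swap_id)
  ultimately show ?case
    using swap by (simp del: o_apply)
qed

text \<open>Makes the sorting permutation of a distinct list unique, so that the \<open>THE\<close>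
  in \<open>alt_ext\<close> can be evaluated.\<close>

lemma distinct_permute_list_inj:
  assumes "distinct xs" "\<pi> permutes {..<length xs}" "\<sigma> permutes {..<length xs}"
    and "permute_list \<pi> xs = permute_list \<sigma> xs"
  shows "\<pi> = \<sigma>"
proof
  fix i
  show "\<pi> i = \<sigma> i"
  proof (cases "i < length xs")
    case True
    then have "xs ! \<pi> i = xs ! \<sigma> i" "\<pi> i < length xs" "\<sigma> i < length xs"
      using permute_list_nth[OF assms(2) True] permute_list_nth[OF assms(3) True] assms
        permutes_in_image[OF assms(2), of i] permutes_in_image[OF assms(3), of i] by auto
    then show ?thesis
      using assms(1) nth_eq_iff_index_eq by blast
  next
    case False
    then show ?thesis
      using assms(2,3) by (simp add: permutes_def)
  qed
qed

lemma sorting_permutation: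
  obtains \<pi> where "\<pi> permutes {..<length xs}" "permute_list \<pi> xs = sort xs"
  using mset_eq_permutation[of "sort xs" xs] by auto

lemma alternating_eq_sorted:
  fixes w w' :: "nat list \<Rightarrow> 'a::ring_1"
  assumes "alternating n p w" "alternating n p w'" "length xs = p" "set xs \<subseteq> {..<n}"
    and eq: "\<And>ys. length ys = p \<Longrightarrow> set ys \<subseteq> {..<n} \<Longrightarrow> sorted_wrt (<) ys \<Longrightarrow> w ys = w' ys"
  shows "w xs = w' xs"
proof (cases "distinct xs")
  case True
  obtain \<pi> where \<pi>: "\<pi> permutes {..<length xs}" "permute_list \<pi> xs = sort xs"
    by (rule sorting_permutation)
  have "w (sort xs) = w' (sort xs)"
    by (rule eq) (use assms True in \<open>auto simp: strict_sorted_iff\<close>)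
  then have "of_int (sign \<pi>) * w xs = of_int (sign \<pi>) * w' xs"
    using alternating_permute[of n p w xs \<pi>] alternating_permute[of n p w' xs \<pi>] assms \<pi> by simp
  \<comment> \<open>A sign is 1 or -1, so it cancels in any ring.\<close>
  then show ?thesis
    by (auto simp: sign_def split: if_splits)
qed (use assms in \<open>auto simp: alternating_def\<close>)

definition alt_ext :: "(nat list \<Rightarrow> 'a::ring_1) \<Rightarrow> nat list \<Rightarrow> 'a" where
  "alt_ext f xs = (if distinct xs
     then of_int (sign (THE \<pi>. \<pi> permutes {..<length xs} \<and> permute_list \<pi> xs = sort xs)) * f (sort xs)
     else 0)"

lemma alt_ext_eq:
  assumes "distinct xs" "\<pi> permutes {..<length xs}" "permute_list \<pi> xs = sort xs"
  shows "alt_ext f xs = of_int (sign \<pi>) * f (sort xs)"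
proof -
  have "(THE \<pi>. \<pi> permutes {..<length xs} \<and> permute_list \<pi> xs = sort xs) = \<pi>"
    by (rule the_equality) (use assms distinct_permute_list_inj in fastforce)+
  then show ?thesis
    using assms by (simp add: alt_ext_def)
qed

lemma alt_ext_sorted: "sorted_wrt (<) xs \<Longrightarrow> alt_ext f xs = f xs"
  using alt_ext_eq[of xs id f] by (auto simp: strict_sorted_iff permutes_id sorted_sort_id)

text \<open>If \<pi> sorts the list with two entries exchanged, then the transposition composed with
  \<pi> sorts the original list. The two lists thus have sorting permutations of opposite sign and
  the same sorted form.\<close>

lemma alternating_alt_ext: "alternating n p (alt_ext f)"
  unfolding alternating_def
proof (intro allI impI conjI)
  fix xs :: "nat list" and i j
  assume xs: "length xs = p \<and> set xs \<subseteq> {..<n}" and ij: "i < p" "j < p" "i \<noteq> j"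
  define ys where "ys = permute_list (transpose i j) xs"
  have ys: "ys = xs[i := xs ! j, j := xs ! i]"
    unfolding ys_def by (rule permute_list_transpose) (use xs ij in auto)
  have tr: "transpose i j permutes {..<p}"
    using ij by (simp add: permutes_swap_id)
  then have mset: "mset ys = mset xs"
    using xs by (simp add: ys_def)
  then have srt: "sort ys = sort xs"
    by (intro properties_for_sort) simp_all
  have len: "length ys = p"
    using xs by (simp add: ys)
  show "alt_ext f (xs[i := xs ! j, j := xs ! i]) = - alt_ext f xs"
  proof (cases "distinct xs")
    case True
    obtain \<pi> where \<pi>: "\<pi> permutes {..<p}" "permute_list \<pi> ys = sort ys"
      using sorting_permutation[of ys] len by auto
    have "permute_list (transpose i j \<circ> \<pi>) xs = sort xs"
      using permute_list_compose[of \<pi> xs "transpose i j"] \<pi> xs srt by (simp add: ys_def)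
    moreover have "transpose i j \<circ> \<pi> permutes {..<p}"
      using \<pi> tr permutes_compose by blast
    ultimately have "alt_ext f xs = of_int (sign (transpose i j \<circ> \<pi>)) * f (sort xs)"
      using alt_ext_eq True xs by blast
    moreover have "sign (transpose i j \<circ> \<pi>) = - sign \<pi>"
      using \<pi>(1) ij permutation_permutes[of \<pi>]
      by (subst sign_compose) (auto simp: permutation_swap_id sign_swap_id)
    moreover have "alt_ext f ys = of_int (sign \<pi>) * f (sort xs)"
      using alt_ext_eq[of ys \<pi> f] \<pi> srt len True mset mset_eq_imp_distinct_iff by force
    ultimately show ?thesis
      unfolding ys by simp
  next
    case False
    then have "\<not> distinct ys"
      using mset mset_eq_imp_distinct_iff by blast
    then show ?thesis
      using False unfolding ys by (simp add: alt_ext_def)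
  qed
qed (simp add: alt_ext_def)

lemma alternating_sum:
  fixes c :: "'b \<Rightarrow> 'a::comm_ring_1"
  assumes "\<And>h. h \<in> A \<Longrightarrow> alternating n p (\<lambda>xs. w xs h)"
  shows "alternating n p (\<lambda>xs. \<Sum>h\<in>A. c h * w xs h)"
  using assms by (auto simp: alternating_def sum_negf intro!: sum.neutral sum.cong)

lemma length3E: "length xs = 3 \<Longrightarrow> (\<And>a b c. xs = [a, b, c] \<Longrightarrow> P) \<Longrightarrow> P"
  by (auto simp: numeral_3_eq_3 length_Suc_conv)

lemma length4E: "length xs = 4 \<Longrightarrow> (\<And>a b c d. xs = [a, b, c, d] \<Longrightarrow> P) \<Longrightarrow> P"
  by (auto simp: numeral_eq_Suc length_Suc_conv)

lemma alternating_swap: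
  assumes "alternating n p w" "length xs = p" "set xs \<subseteq> {..<n}" "i < p" "j < p" "i \<noteq> j"
  shows "w (xs[i := xs ! j, j := xs ! i]) = - w xs"
  using assms by (simp add: alternating_def)

lemma alternating2:
  assumes "alternating n 2 w" "a < n" "b < n"
  shows "w [b, a] = - w [a, b]"
  using alternating_swap[OF assms(1), of "[a, b]" 0 1] assms by simp

lemma alternating3:
  assumes "alternating n 3 w" "a < n" "b < n" "c < n"
  shows "w [b, a, c] = - w [a, b, c]" "w [a, c, b] = - w [a, b, c]" "w [c, b, a] = - w [a, b, c]"
    "w [b, c, a] = w [a, b, c]" "w [c, a, b] = w [a, b, c]"
    "w [a, a, b] = 0" "w [a, b, a] = 0" "w [b, a, a] = 0"
proof -
  have *: "w [y, x, z] = - w [x, y, z]" "w [x, z, y] = - w [x, y, z]"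
    if "x < n" "y < n" "z < n" for x y z
    using alternating_swap[OF assms(1), of "[x, y, z]" 0 1]
      alternating_swap[OF assms(1), of "[x, y, z]" 1 2] that by simp_all
  show "w [b, a, c] = - w [a, b, c]" "w [a, c, b] = - w [a, b, c]" "w [c, b, a] = - w [a, b, c]"
    "w [b, c, a] = w [a, b, c]" "w [c, a, b] = w [a, b, c]"
    using *[of a b c] *(1)[of b c a] *(2)[of b a c] *(1)[of a c b] assms by simp_all
  show "w [a, a, b] = 0" "w [a, b, a] = 0" "w [b, a, a] = 0"
    using assms by (simp_all add: alternating_def)
qed

lemma alternating4_swap:
  assumes "alternating n 4 w" "a < n" "b < n" "c < n" "d < n"
  shows "w [b, a, c, d] = - w [a, b, c, d]" "w [a, c, b, d] = - w [a, b, c, d]"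
    "w [a, b, d, c] = - w [a, b, c, d]"
  using alternating_swap[OF assms(1), of "[a, b, c, d]" 0 1]
    alternating_swap[OF assms(1), of "[a, b, c, d]" 1 2]
    alternating_swap[OF assms(1), of "[a, b, c, d]" 2 3] assms by simp_all

lemma alternating5_swap:
  assumes "alternating n 5 w" "a < n" "b < n" "c < n" "d < n" "e < n"
  shows "w [b, a, c, d, e] = - w [a, b, c, d, e]" "w [a, c, b, d, e] = - w [a, b, c, d, e]"
    "w [a, b, d, c, e] = - w [a, b, c, d, e]" "w [a, b, c, e, d] = - w [a, b, c, d, e]"
  using alternating_swap[OF assms(1), of "[a, b, c, d, e]" 0 1]
    alternating_swap[OF assms(1), of "[a, b, c, d, e]" 1 2]
    alternating_swap[OF assms(1), of "[a, b, c, d, e]" 2 3]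
    alternating_swap[OF assms(1), of "[a, b, c, d, e]" 3 4] assms by simp_all

text \<open>Exchanging distant positions is a product of three adjacent exchanges, and adjacent
  exchanges also bring a repeated pair to the front. Vanishing on a repeated pair is a premise of
  its own because x = -x does not give x = 0 in a general abelian group.\<close>

lemma alternating3I:
  assumes "\<And>a b c. \<lbrakk>a < n; b < n; c < n\<rbrakk> \<Longrightarrow> w [b, a, c] = - w [a, b, c]"
    and "\<And>a b c. \<lbrakk>a < n; b < n; c < n\<rbrakk> \<Longrightarrow> w [a, c, b] = - w [a, b, c]"
    and "\<And>a b. \<lbrakk>a < n; b < n\<rbrakk> \<Longrightarrow> w [a, a, b] = 0"
  shows "alternating n 3 w"
  unfolding alternating_def
proof (intro allI impI)
  fix xs :: "nat list"
  assume xs: "length xs = 3 \<and> set xs \<subseteq> {..<n}"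
  then obtain a b c where abc: "xs = [a, b, c]" by (auto elim: length3E)
  with xs have lt: "a < n" "b < n" "c < n" by auto
  have "w [x, x, y] = 0" "w [x, y, x] = 0" "w [y, x, x] = 0" if "x < n" "y < n" for x y
    using assms(3)[of x y] assms(2)[of x x y] assms(1)[of x y x] that by simp_all
  with lt have z: "\<not> distinct xs \<Longrightarrow> w xs = 0"
    by (auto simp: abc)
  have "w [b, a, c] = - w [a, b, c]" "w [a, c, b] = - w [a, b, c]" "w [c, b, a] = - w [a, b, c]"
    using assms(1)[of a b c] assms(2)[of a b c] assms(1)[of b c a] assms(2)[of b a c] lt by simp_all
  then have "\<forall>i<3. \<forall>j<3. i \<noteq> j \<longrightarrow> w (xs[i := xs ! j, j := xs ! i]) = - w xs"
    by (simp add: abc numeral_eq_Suc All_less_Suc2)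
  with z show "(\<not> distinct xs \<longrightarrow> w xs = 0) \<and>
      (\<forall>i<3. \<forall>j<3. i \<noteq> j \<longrightarrow> w (xs[i := xs ! j, j := xs ! i]) = - w xs)"
    by blast
qed

lemma alternating4I:
  assumes "\<And>a b c d. \<lbrakk>a < n; b < n; c < n; d < n\<rbrakk> \<Longrightarrow> w [b, a, c, d] = - w [a, b, c, d]"
    and "\<And>a b c d. \<lbrakk>a < n; b < n; c < n; d < n\<rbrakk> \<Longrightarrow> w [a, c, b, d] = - w [a, b, c, d]"
    and "\<And>a b c d. \<lbrakk>a < n; b < n; c < n; d < n\<rbrakk> \<Longrightarrow> w [a, b, d, c] = - w [a, b, c, d]"
    and zero: "\<And>a b c. \<lbrakk>a < n; b < n; c < n\<rbrakk> \<Longrightarrow> w [a, a, b, c] = 0"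
  shows "alternating n 4 w"
  unfolding alternating_def
proof (intro allI impI)
  note s = assms(1-3)
  fix xs :: "nat list"
  assume xs: "length xs = 4 \<and> set xs \<subseteq> {..<n}"
  then obtain a b c d where abcd: "xs = [a, b, c, d]" by (auto elim: length4E)
  with xs have lt: "a < n" "b < n" "c < n" "d < n" by auto
  have t13: "w [c, b, a, d] = - w [a, b, c, d]" "w [a, d, c, b] = - w [a, b, c, d]"
    if "a < n" "b < n" "c < n" "d < n" for a b c d
    using s(1)[of a b c d] s(2)[of b a c d] s(1)[of b c a d]
      s(2)[of a b c d] s(3)[of a c b d] s(2)[of a c d b] that by simp_all
  have t14: "w [d, b, c, a] = - w [a, b, c, d]"
    using s(1)[of a b c d] t13(2)[of b a c d] s(1)[of b d c a] lt by simp
  have "w [x, x, y, z] = 0" "w [x, y, x, z] = 0" "w [y, x, x, z] = 0"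
    "w [x, y, z, x] = 0" "w [y, x, z, x] = 0" "w [y, z, x, x] = 0"
    if "x < n" "y < n" "z < n" for x y z
    using zero[of x y z] s(2)[of x x y z] s(1)[of x y x z] s(3)[of x y x z] s(1)[of x y z x]
      s(2)[of y x z x] that by simp_all
  with lt have "w xs = 0" if "\<not> distinct xs"
    using that by (auto simp: abcd)
  moreover have "\<forall>i<4. \<forall>j<4. i \<noteq> j \<longrightarrow> w (xs[i := xs ! j, j := xs ! i]) = - w xs"
    using s[OF lt] t13[OF lt] t14 by (simp add: abcd numeral_eq_Suc All_less_Suc2)
  ultimately show "(\<not> distinct xs \<longrightarrow> w xs = 0) \<and>
      (\<forall>i<4. \<forall>j<4. i \<noteq> j \<longrightarrow> w (xs[i := xs ! j, j := xs ! i]) = - w xs)"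
    by blast
qed

text \<open>This is the right-hand side of \<open>is_w3_1\<close> as a function of the list of
  indices, the form in which \<open>alternating_eq_sorted\<close> can use it.
  \<open>alternating_wedge\<close> does the same for \<open>is_w1_1\<close>.\<close>

lemma alternating_minor:
  fixes d :: "'a::comm_ring_1 mat"
  shows "alternating n 3 (\<lambda>xs. minor d (xs ! 0) (xs ! 1) * of_bool (k = xs ! 2)
    - minor d (xs ! 0) (xs ! 2) * of_bool (k = xs ! 1)
    + minor d (xs ! 1) (xs ! 2) * of_bool (k = xs ! 0))"
  by (rule alternating3I) (simp_all add: minor_def algebra_simps)

lemma alternating_wedge:
  fixes x :: "nat \<Rightarrow> 'a::comm_ring_1"
  assumes w: "alternating n 3 w"
  shows "alternating n 4 (\<lambda>xs. x (xs ! 0) * w [xs ! 1, xs ! 2, xs ! 3]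
    - x (xs ! 1) * w [xs ! 0, xs ! 2, xs ! 3] + x (xs ! 2) * w [xs ! 0, xs ! 1, xs ! 3]
    - x (xs ! 3) * w [xs ! 0, xs ! 1, xs ! 2])" (is "alternating n 4 ?f")
proof (rule alternating4I)
  fix a b c d
  assume "a < n" "b < n" "c < n" "d < n"
  then show "?f [b, a, c, d] = - ?f [a, b, c, d]" "?f [a, c, b, d] = - ?f [a, b, c, d]"
      "?f [a, b, d, c] = - ?f [a, b, c, d]"
    using alternating3(1,2)[OF w, of a b c] alternating3(1,2)[OF w, of a b d]
      alternating3(1,2)[OF w, of a c d] alternating3(1,2)[OF w, of b c d]
    by (simp_all add: algebra_simps)
next
  fix a b c
  assume "a < n" "b < n" "c < n"
  then show "?f [a, a, b, c] = 0"
    using alternating3(6)[OF w, of a b] alternating3(6)[OF w, of a c] by simp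
qed

text \<open>Allows some arguments to be frozen at the end while the others are renumbered, as in the
  passage from \<open>i\<close> to the position \<open>r3 + i\<close> of s_i.\<close>

lemma alternating_map_append:
  assumes w: "alternating N (p + length ys) w" and f: "inj_on f {..<n}" "f ` {..<n} \<subseteq> {..<N}"
    and ys: "set ys \<subseteq> {..<N}"
  shows "alternating n p (\<lambda>xs. w (map f xs @ ys))"
  unfolding alternating_def
proof (intro allI impI conjI)
  fix xs assume xs: "length xs = p \<and> set xs \<subseteq> {..<n}"
  then have sub: "length (map f xs @ ys) = p + length ys" "set (map f xs @ ys) \<subseteq> {..<N}"
    using f ys by auto
  show "w (map f xs @ ys) = 0" if "\<not> distinct xs"
    using w sub that f(1) xs by (auto simp: alternating_def distinct_map)
  fix i j assume ij: "i < p" "j < p" "i \<noteq> j"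
  have "map f (xs[i := xs ! j, j := xs ! i]) @ ys
      = (map f xs @ ys)[i := (map f xs @ ys) ! j, j := (map f xs @ ys) ! i]"
    using xs ij by (simp add: map_update list_update_append nth_append)
  then show "w (map f (xs[i := xs ! j, j := xs ! i]) @ ys) = - w (map f xs @ ys)"
    using alternating_swap[OF w sub] ij by simp
qed

text \<open>The lifting conditions have their distinguished indices in front, whereas the linked
  complex uses the fixed list \<open>[0,1,2,3]\<close>. The table covers moving one or two entries
  to the front, and the first entry to the end.\<close>

lemma alternating4_perm:
  assumes "alternating n 4 w" "a < n" "b < n" "c < n" "d < n"
  shows "w [b,a,c,d] = - w [a,b,c,d]" "w [c,a,b,d] = w [a,b,c,d]" "w [d,a,b,c] = - w [a,b,c,d]"
    "w [a,c,b,d] = - w [a,b,c,d]" "w [a,d,b,c] = w [a,b,c,d]" "w [b,c,a,d] = w [a,b,c,d]"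
    "w [b,d,a,c] = - w [a,b,c,d]" "w [c,d,a,b] = w [a,b,c,d]" "w [c,b,a,d] = - w [a,b,c,d]"
    "w [d,b,a,c] = w [a,b,c,d]" "w [d,c,a,b] = - w [a,b,c,d]" "w [b,c,d,a] = - w [a,b,c,d]"
proof -
  note s = alternating4_swap[OF assms(1)]
  have *: "w [b,a,c,d] = - w [a,b,c,d]" "w [c,a,b,d] = w [a,b,c,d]" "w [d,a,b,c] = - w [a,b,c,d]"
    "w [a,c,b,d] = - w [a,b,c,d]" "w [a,d,b,c] = w [a,b,c,d]" "w [b,c,a,d] = w [a,b,c,d]"
    if "a < n" "b < n" "c < n" "d < n" for a b c d
    using s(1)[of a b c d] s(2)[of a b c d] s(1)[of a c b d] s(3)[of a b c d] s(2)[of a b d c]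
      s(1)[of a d b c] s(2)[of b a c d] that by simp_all
  show "w [b,a,c,d] = - w [a,b,c,d]" "w [c,a,b,d] = w [a,b,c,d]" "w [d,a,b,c] = - w [a,b,c,d]"
    "w [a,c,b,d] = - w [a,b,c,d]" "w [a,d,b,c] = w [a,b,c,d]" "w [b,c,a,d] = w [a,b,c,d]"
    using *[of a b c d] assms by blast+
  show "w [c,b,a,d] = - w [a,b,c,d]" "w [b,d,a,c] = - w [a,b,c,d]" "w [b,c,d,a] = - w [a,b,c,d]"
    using *(2)[of b a c d] *(1)[of a b c d] *(5)[of b a c d] s(3)[of b c a d] *(6)[of a b c d] assms
    by simp_all
  show "w [c,d,a,b] = w [a,b,c,d]" "w [d,b,a,c] = w [a,b,c,d]" "w [d,c,a,b] = - w [a,b,c,d]"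
    using *(3)[of b a c d] *(1)[of a b c d] *(5)[of c a b d] *(3)[of c a b d] *(2)[of a b c d] assms
    by simp_all
qed

subsection \<open>Relations among the structure maps\<close>

lemma sum_swap_mult:
  fixes a :: "'b \<Rightarrow> 'a::comm_semiring_0"
  shows "(\<Sum>t\<in>A. a t * (\<Sum>h\<in>B. x h * w h t)) = (\<Sum>h\<in>B. x h * (\<Sum>t\<in>A. a t * w h t))"
  unfolding sum_distrib_left by (subst sum.swap) (simp add: mult.left_commute)

lemma sum_of_bool:
  fixes f :: "nat \<Rightarrow> 'a::comm_semiring_1"
  assumes "k < n"
  shows "(\<Sum>x<n. of_bool (x = k) * f x) = f k" "(\<Sum>x<n. of_bool (k = x) * f x) = f k"
    "(\<Sum>x<n. f x * of_bool (x = k)) = f k" "(\<Sum>x<n. f x * of_bool (k = x)) = f k"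
  using assms by (simp_all add: of_bool_def if_distrib[of "\<lambda>a. _ * a"] if_distrib[of "\<lambda>a. a * _"] cong: if_cong)

section \<open>Contractions of \<open>w2\<close> and \<open>w1\<close> with \<open>a3\<close>,
  \<open>w3\<close> and \<open>a2\<close>\<close>

locale structure_maps =
  fixes r1 r2 r3 :: nat and a1 a2 a3 :: "'a::comm_ring_1 mat"
    and w3 :: "nat list \<Rightarrow> nat \<Rightarrow> 'a" and w2 w1 :: "nat list \<Rightarrow> nat \<Rightarrow> nat \<Rightarrow> 'a"
  assumes dims: "a1 \<in> carrier_mat 2 r1" "a2 \<in> carrier_mat r1 r2" "a3 \<in> carrier_mat r2 r3"
    and a1_a2: "\<And>c n. c < 2 \<Longrightarrow> n < r2 \<Longrightarrow> (\<Sum>k<r1. a1 $$ (c, k) * a2 $$ (k, n)) = 0"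
    and a2_a3: "\<And>k t. k < r1 \<Longrightarrow> t < r3 \<Longrightarrow> (\<Sum>n<r2. a2 $$ (k, n) * a3 $$ (n, t)) = 0"
    and a3_inj: "\<And>x t. (\<And>n. n < r2 \<Longrightarrow> (\<Sum>t<r3. a3 $$ (n, t) * x t) = 0) \<Longrightarrow> t < r3 \<Longrightarrow> x t = 0"
    and w3: "is_w3_1 a1 a2 w3" and w2: "is_w2_1 a1 a2 a3 w3 w2" and w1: "is_w1_1 a1 a3 w3 w1"
begin

lemma a3_cancel:
  assumes "\<And>n. n < r2 \<Longrightarrow> (\<Sum>t<r3. a3 $$ (n, t) * x t) = (\<Sum>t<r3. a3 $$ (n, t) * y t)" "t < r3"
  shows "x t = y t"
  using a3_inj[of "\<lambda>t. x t - y t" t] assms by (simp add: right_diff_distrib sum_subtractf)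

lemma w3_alt: "h < r2 \<Longrightarrow> alternating r1 3 (\<lambda>xs. w3 xs h)"
  and w2_alt: "h < r2 \<Longrightarrow> t < r3 \<Longrightarrow> alternating r1 2 (\<lambda>xs. w2 xs h t)"
  and w1_alt: "c < 2 \<Longrightarrow> t < r3 \<Longrightarrow> alternating r1 4 (\<lambda>xs. w1 xs c t)"
  using w3 w2 w1 dims by (auto simp: is_w3_1_def is_w2_1_def is_w1_1_def Let_def)

lemmas w3_perm = alternating3[OF w3_alt]
lemmas w2_perm = alternating2[OF w2_alt]
lemmas w1_swap = alternating4_swap[OF w1_alt]

lemma a2_w3:
  assumes "i < r1" "j < r1" "k < r1" "n < r1"
  shows "(\<Sum>h<r2. a2 $$ (n, h) * w3 [i,j,k] h) = minor a1 i j * of_bool (n = k)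
    - minor a1 i k * of_bool (n = j) + minor a1 j k * of_bool (n = i)"
  using w3 assms dims by (auto simp: is_w3_1_def Let_def)

lemma a3_w2:
  assumes "i < r1" "j < r1" "h < r2" "n < r2"
  shows "(\<Sum>t<r3. a3 $$ (n, t) * w2 [i,j] h t) =
    minor a1 i j * of_bool (n = h) - (\<Sum>k<r1. a2 $$ (k, h) * w3 [k,i,j] n)"
  using w2 assms dims by (auto simp: is_w2_1_def Let_def)

lemma a3_w1:
  assumes "i < r1" "j < r1" "k < r1" "l < r1" "c < 2" "n < r2"
  shows "(\<Sum>t<r3. a3 $$ (n, t) * w1 [i,j,k,l] c t) =
    a1 $$ (c, i) * w3 [j,k,l] n - a1 $$ (c, j) * w3 [i,k,l] n
    + a1 $$ (c, k) * w3 [i,j,l] n - a1 $$ (c, l) * w3 [i,j,k] n"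
  using w1 assms dims by (auto simp: is_w1_1_def Let_def)

text \<open>The vector \<open>x\<close> enters the last term only through its image under
  \<open>a2\<close>. This image is 0 for a column of \<open>a3\<close> and is given by
  \<open>a2_w3\<close> for a value of \<open>w3\<close>, the two cases that occur.\<close>

lemma a3_w2_contract:
  assumes "i < r1" "j < r1" "n < r2"
  shows "(\<Sum>t<r3. a3 $$ (n, t) * (\<Sum>h<r2. x h * w2 [i,j] h t)) =
    minor a1 i j * x n - (\<Sum>k<r1. (\<Sum>h<r2. a2 $$ (k, h) * x h) * w3 [k,i,j] n)"
proof -
  have "(\<Sum>t<r3. a3 $$ (n, t) * (\<Sum>h<r2. x h * w2 [i,j] h t))
      = (\<Sum>h<r2. x h * (\<Sum>t<r3. a3 $$ (n, t) * w2 [i,j] h t))"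
    by (rule sum_swap_mult)
  also have "\<dots> = (\<Sum>h<r2. minor a1 i j * x h * of_bool (n = h) - x h * (\<Sum>k<r1. w3 [k,i,j] n * a2 $$ (k, h)))"
    using assms by (intro sum.cong) (simp_all add: a3_w2 right_diff_distrib mult_ac)
  also have "\<dots> = minor a1 i j * x n - (\<Sum>k<r1. w3 [k,i,j] n * (\<Sum>h<r2. x h * a2 $$ (k, h)))"
    unfolding sum_subtractf sum_of_bool(4)[OF assms(3)] sum_swap_mult[of "\<lambda>k. w3 [k,i,j] n" x] ..
  finally show ?thesis
    by (simp add: mult_ac)
qed

text \<open>On the image of \<open>a3\<close> the \<open>w3\<close> term of the defining equation of
  \<open>w2\<close> is lost because a2 a3 = 0, and only multiplication by the minor remains.\<close>

lemma w2_a3: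
  assumes "i < r1" "j < r1" "t < r3" "u < r3"
  shows "(\<Sum>h<r2. a3 $$ (h, u) * w2 [i,j] h t) = minor a1 i j * of_bool (u = t)"
proof (rule a3_cancel[of "\<lambda>t. (\<Sum>h<r2. a3 $$ (h, u) * w2 [i,j] h t)", OF _ assms(3)])
  fix n assume "n < r2"
  then show "(\<Sum>t<r3. a3 $$ (n, t) * (\<Sum>h<r2. a3 $$ (h, u) * w2 [i, j] h t))
      = (\<Sum>t<r3. a3 $$ (n, t) * (minor a1 i j * of_bool (u = t)))"
    using assms sum_of_bool(4)[of u r3 "\<lambda>t. a3 $$ (n, t) * minor a1 i j"]
    by (simp add: a3_w2_contract a2_a3 mult_ac)
qed

lemma a3_w2_w3:
  assumes "a < r1" "b < r1" "c < r1" "i < r1" "j < r1" "n < r2"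
  shows "(\<Sum>t<r3. a3 $$ (n, t) * (\<Sum>h<r2. w3 [a,b,c] h * w2 [i,j] h t)) =
    minor a1 i j * w3 [a,b,c] n - minor a1 a b * w3 [c,i,j] n + minor a1 a c * w3 [b,i,j] n
    - minor a1 b c * w3 [a,i,j] n"
proof -
  have "(\<Sum>k<r1. (\<Sum>h<r2. a2 $$ (k, h) * w3 [a,b,c] h) * w3 [k,i,j] n)
    = (\<Sum>k<r1. minor a1 a b * (of_bool (k = c) * w3 [k,i,j] n)
        - minor a1 a c * (of_bool (k = b) * w3 [k,i,j] n)
        + minor a1 b c * (of_bool (k = a) * w3 [k,i,j] n))"
    using assms by (simp add: a2_w3 algebra_simps)
  also have "\<dots> = minor a1 a b * w3 [c,i,j] n - minor a1 a c * w3 [b,i,j] n + minor a1 b c * w3 [a,i,j] n"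
    using assms by (simp add: sum.distrib sum_subtractf sum_distrib_left[symmetric] sum_of_bool)
  finally show ?thesis
    by (simp add: a3_w2_contract[OF assms(4-6)])
qed

text \<open>The coefficient of \<open>g\<^sub>t\<close> in \<open>d\<^sub>1(e\<^sub>p) \<and> w\<^sup>(\<^sup>1\<^sup>)\<^sub>1(e\<^sub>i \<and> e\<^sub>j \<and> e\<^sub>k \<and> e\<^sub>l)\<close>, for \<open>xs = [i, j, k, l]\<close>.\<close>

definition wedge1 :: "nat \<Rightarrow> nat list \<Rightarrow> nat \<Rightarrow> 'a" where
  "wedge1 p xs t = a1 $$ (0, p) * w1 xs 1 t - a1 $$ (1, p) * w1 xs 0 t"

lemma w1_swap_wedge1:
  assumes "i < r1" "j < r1" "k < r1" "l < r1" "t < r3"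
  shows "wedge1 p [j,i,k,l] t = - wedge1 p [i,j,k,l] t" "wedge1 p [i,k,j,l] t = - wedge1 p [i,j,k,l] t"
    "wedge1 p [i,j,l,k] t = - wedge1 p [i,j,k,l] t"
  using w1_swap[of 0 t i j k l] w1_swap[of 1 t i j k l] assms by (simp_all add: wedge1_def)

text \<open>Wedge the lifting condition of \<open>w1\<close> with a1(e_i): the term with a1(e_i)
  dies and the other three columns turn into minors.\<close>

lemma a3_wedge1:
  assumes "i < r1" "j < r1" "k < r1" "l < r1" "n < r2"
  shows "(\<Sum>t<r3. a3 $$ (n, t) * wedge1 i [i,j,k,l] t) =
    - minor a1 i j * w3 [i,k,l] n + minor a1 i k * w3 [i,j,l] n - minor a1 i l * w3 [i,j,k] n"
proof -
  have "(\<Sum>t<r3. a3 $$ (n, t) * wedge1 i [i,j,k,l] t)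
    = a1 $$ (0, i) * (\<Sum>t<r3. a3 $$ (n, t) * w1 [i,j,k,l] 1 t)
      - a1 $$ (1, i) * (\<Sum>t<r3. a3 $$ (n, t) * w1 [i,j,k,l] 0 t)"
    by (simp add: wedge1_def right_diff_distrib sum_subtractf sum_distrib_left mult_ac)
  then show ?thesis
    using assms by (simp add: a3_w1 minor_def algebra_simps)
qed

text \<open>When the triple contains both indices of the pair, two terms of \<open>a3_w2_w3\<close>
  have a repeated index in \<open>w3\<close> and the other two cancel by a cyclic shift.\<close>

lemma w2_w3:
  assumes "i < r1" "j < r1" "p < r1" "t < r3"
  shows "(\<Sum>h<r2. w3 [i,j,p] h * w2 [i,j] h t) = 0"
proof -
  have "(\<Sum>t<r3. a3 $$ (n, t) * (\<Sum>h<r2. w3 [i,j,p] h * w2 [i,j] h t)) = 0" if "n < r2" for n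
    using assms that w3_perm[of n i j p] w3_perm(6-8)[of n i j] w3_perm(6-8)[of n j i]
    by (simp add: a3_w2_w3)
  then show ?thesis
    using a3_inj[of "\<lambda>t. \<Sum>h<r2. w3 [i,j,p] h * w2 [i,j] h t"] assms by blast
qed

text \<open>With one common index, one term of \<open>a3_w2_w3\<close> vanishes and the remaining
  three are those of \<open>a3_wedge1\<close>.\<close>

lemma w2_w3_wedge1:
  assumes "i < r1" "j < r1" "p < r1" "q < r1" "t < r3"
  shows "(\<Sum>h<r2. w3 [i,p,q] h * w2 [i,j] h t) = - wedge1 i [i,j,p,q] t"
proof (rule a3_cancel[of "\<lambda>t. \<Sum>h<r2. w3 [i,p,q] h * w2 [i,j] h t", OF _ assms(5)])
  fix n assume "n < r2"
  then show "(\<Sum>t<r3. a3 $$ (n, t) * (\<Sum>h<r2. w3 [i,p,q] h * w2 [i,j] h t))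
      = (\<Sum>t<r3. a3 $$ (n, t) * - wedge1 i [i,j,p,q] t)"
    using assms w3_perm[of n i j q] w3_perm[of n i j p] w3_perm(6-8)[of n i j]
    by (simp add: a3_w2_w3 a3_wedge1 sum_negf)
qed

text \<open>After composing with \<open>a\<^sub>3\<close>, the terms containing \<open>a\<^sub>1(e\<^sub>k)\<close> cancel because \<open>a\<^sub>1 a\<^sub>2 = 0\<close>.\<close>

lemma a2_w1:
  assumes "i < r1" "j < r1" "l < r1" "c < 2" "n < r2" "t < r3"
  shows "(\<Sum>k<r1. a2 $$ (k, n) * w1 [i,j,l,k] c t) =
    - (a1 $$ (c, i) * w2 [j,l] n t - a1 $$ (c, j) * w2 [i,l] n t + a1 $$ (c, l) * w2 [i,j] n t)"
proof (rule a3_cancel[of "\<lambda>t. \<Sum>k<r1. a2 $$ (k, n) * w1 [i,j,l,k] c t", OF _ assms(6)])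
  fix p assume p: "p < r2"
  define S where "S i j = (\<Sum>k<r1. a2 $$ (k, n) * w3 [k,i,j] p)" for i j
  have rot: "w3 [i,j,k] p = w3 [k,i,j] p" if "i < r1" "j < r1" "k < r1" for i j k
    using w3_perm(5)[of p i j k] that p by simp
  have "(\<Sum>t<r3. a3 $$ (p, t) * (\<Sum>k<r1. a2 $$ (k, n) * w1 [i,j,l,k] c t))
    = (\<Sum>k<r1. a1 $$ (c, i) * (a2 $$ (k, n) * w3 [k,j,l] p) - a1 $$ (c, j) * (a2 $$ (k, n) * w3 [k,i,l] p)
        + a1 $$ (c, l) * (a2 $$ (k, n) * w3 [k,i,j] p) - (a1 $$ (c, k) * a2 $$ (k, n)) * w3 [i,j,l] p)"
    using assms p rot by (simp add: sum_swap_mult a3_w1 algebra_simps)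
  also have "\<dots> = a1 $$ (c, i) * S j l - a1 $$ (c, j) * S i l + a1 $$ (c, l) * S i j"
    using assms by (simp add: S_def sum.distrib sum_subtractf sum_distrib_left[symmetric]
      sum_distrib_right[symmetric] a1_a2)
  finally have L: "(\<Sum>t<r3. a3 $$ (p, t) * (\<Sum>k<r1. a2 $$ (k, n) * w1 [i,j,l,k] c t))
    = a1 $$ (c, i) * S j l - a1 $$ (c, j) * S i l + a1 $$ (c, l) * S i j" .
  have "(\<Sum>t<r3. a3 $$ (p, t) * - (a1 $$ (c, i) * w2 [j,l] n t - a1 $$ (c, j) * w2 [i,l] n t + a1 $$ (c, l) * w2 [i,j] n t))
    = (\<Sum>t<r3. a1 $$ (c, j) * (a3 $$ (p, t) * w2 [i,l] n t) - a1 $$ (c, i) * (a3 $$ (p, t) * w2 [j,l] n t)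
       - a1 $$ (c, l) * (a3 $$ (p, t) * w2 [i,j] n t))"
    by (rule sum.cong) (simp_all add: algebra_simps)
  also have "\<dots> = a1 $$ (c, j) * (minor a1 i l * of_bool (p = n) - S i l)
      - a1 $$ (c, i) * (minor a1 j l * of_bool (p = n) - S j l)
      - a1 $$ (c, l) * (minor a1 i j * of_bool (p = n) - S i j)"
    using assms p by (simp add: S_def sum_subtractf sum_distrib_left[symmetric] a3_w2)
  also have "\<dots> = a1 $$ (c, i) * S j l - a1 $$ (c, j) * S i l + a1 $$ (c, l) * S i j"
  proof -
    \<comment> \<open>What is left at \<open>p = n\<close> is the three-term relation between the
      vectors a1(e_i), a1(e_j), a1(e_l) in a module of rank 2.\<close>
    have "c = 0 \<or> c = 1" using assms by linarith
    then show ?thesis by (auto simp: minor_def algebra_simps)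
  qed
  finally show "(\<Sum>t<r3. a3 $$ (p, t) * (\<Sum>k<r1. a2 $$ (k, n) * w1 [i,j,l,k] c t)) =
    (\<Sum>t<r3. a3 $$ (p, t) * - (a1 $$ (c, i) * w2 [j,l] n t - a1 $$ (c, j) * w2 [i,l] n t + a1 $$ (c, l) * w2 [i,j] n t))"
    using L by simp
qed

end

section \<open>Contractions of \<open>w221\<close> and \<open>w121\<close>\<close>

locale structure_maps_21 = structure_maps +
  fixes w321 :: "nat list \<Rightarrow> nat \<Rightarrow> nat \<Rightarrow> nat \<Rightarrow> 'a"
    and w221 :: "nat list \<Rightarrow> nat \<Rightarrow> nat \<Rightarrow> nat \<Rightarrow> nat \<Rightarrow> 'a"
  assumes w321: "is_w3_21 a1 a3 w3 w321" and w221: "is_w2_21 a1 a2 a3 w3 w2 w1 w321 w221"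
begin

lemma w321_alt: "p < r1 \<Longrightarrow> h < r2 \<Longrightarrow> t < r3 \<Longrightarrow> alternating r1 5 (\<lambda>xs. w321 xs p h t)"
  and w221_alt: "p < r1 \<Longrightarrow> h < r2 \<Longrightarrow> t < r3 \<Longrightarrow> u < r3 \<Longrightarrow> alternating r1 4 (\<lambda>xs. w221 xs p h t u)"
  using w321 w221 dims by (auto simp: is_w3_21_def is_w2_21_def Let_def)

lemma w221_skew:
  assumes "i < r1" "j < r1" "k < r1" "l < r1" "h < r2"
  shows "skew r3 (w221 [i,j,k,l] i h)"
  using w221 assms dims by (auto simp: is_w2_21_def Let_def)

lemmas w321_swap = alternating5_swap[OF w321_alt]
lemmas w221_swap = alternating4_swap[OF w221_alt]

lemma a3_w221:
  assumes "i < r1" "j < r1" "k < r1" "l < r1" "h < r2" "n < r2" "u < r3"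
  shows "(\<Sum>t<r3. a3 $$ (n, t) * w221 [i,j,k,l] i h t u) =
    w3 [i,j,k] n * w2 [i,l] h u - w3 [i,j,l] n * w2 [i,k] h u + w3 [i,k,l] n * w2 [i,j] h u
    + of_bool (n = h) * wedge1 i [i,j,k,l] u + (\<Sum>x<r1. a2 $$ (x, h) * w321 [i,j,k,l,x] i n u)"
  using w221 assms dims by (auto simp: is_w2_21_def Let_def iota_def wedge1_def)

lemma a3_w221_contract:
  assumes "i < r1" "j < r1" "k < r1" "l < r1" "n < r2" "u < r3"
  shows "(\<Sum>t<r3. a3 $$ (n, t) * (\<Sum>h<r2. x h * w221 [i,j,k,l] i h t u)) =
    w3 [i,j,k] n * (\<Sum>h<r2. x h * w2 [i,l] h u) - w3 [i,j,l] n * (\<Sum>h<r2. x h * w2 [i,k] h u)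
    + w3 [i,k,l] n * (\<Sum>h<r2. x h * w2 [i,j] h u) + x n * wedge1 i [i,j,k,l] u
    + (\<Sum>y<r1. (\<Sum>h<r2. a2 $$ (y, h) * x h) * w321 [i,j,k,l,y] i n u)"
proof -
  have "(\<Sum>t<r3. a3 $$ (n, t) * (\<Sum>h<r2. x h * w221 [i,j,k,l] i h t u))
    = (\<Sum>h<r2. x h * (\<Sum>t<r3. a3 $$ (n, t) * w221 [i,j,k,l] i h t u))"
    by (rule sum_swap_mult)
  also have "\<dots> = (\<Sum>h<r2. w3 [i,j,k] n * (x h * w2 [i,l] h u) - w3 [i,j,l] n * (x h * w2 [i,k] h u)
        + w3 [i,k,l] n * (x h * w2 [i,j] h u) + wedge1 i [i,j,k,l] u * x h * of_bool (n = h)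
        + x h * (\<Sum>y<r1. w321 [i,j,k,l,y] i n u * a2 $$ (y, h)))"
    using assms by (intro sum.cong) (simp_all add: a3_w221 ring_distribs mult_ac)
  also have "\<dots> = w3 [i,j,k] n * (\<Sum>h<r2. x h * w2 [i,l] h u) - w3 [i,j,l] n * (\<Sum>h<r2. x h * w2 [i,k] h u)
    + w3 [i,k,l] n * (\<Sum>h<r2. x h * w2 [i,j] h u) + wedge1 i [i,j,k,l] u * x n
    + (\<Sum>y<r1. w321 [i,j,k,l,y] i n u * (\<Sum>h<r2. x h * a2 $$ (y, h)))"
    unfolding sum.distrib sum_subtractf sum_of_bool(4)[OF assms(5)] sum_distrib_left[symmetric]
      sum_swap_mult[of "\<lambda>y. w321 [i,j,k,l,y] i n u" x] ..
  finally show ?thesis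
    by (simp add: mult_ac)
qed

text \<open>Contracting the three \<open>w2\<close> factors with a column of \<open>a3\<close>
  leaves minors by \<open>w2_a3\<close>; \<open>a3_wedge1\<close>, read backwards, recognises the
  resulting sum as minus the image of \<open>wedge1\<close>.\<close>

lemma w221_a3:
  assumes "i < r1" "j < r1" "k < r1" "l < r1" "t < r3" "u < r3" "v < r3"
  shows "(\<Sum>h<r2. a3 $$ (h, v) * w221 [i,j,k,l] i h t u)
    = of_bool (v = t) * wedge1 i [i,j,k,l] u - of_bool (v = u) * wedge1 i [i,j,k,l] t"
proof (rule a3_cancel[of "\<lambda>t. \<Sum>h<r2. a3 $$ (h, v) * w221 [i,j,k,l] i h t u", OF _ assms(5)])
  fix n assume n: "n < r2"
  have "(\<Sum>t<r3. a3 $$ (n, t) * (of_bool (v = t) * wedge1 i [i,j,k,l] u - of_bool (v = u) * wedge1 i [i,j,k,l] t))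
    = (\<Sum>t<r3. (a3 $$ (n, t) * wedge1 i [i,j,k,l] u) * of_bool (v = t)
        - of_bool (v = u) * (a3 $$ (n, t) * wedge1 i [i,j,k,l] t))"
    by (rule sum.cong) (simp_all add: algebra_simps)
  also have "\<dots> = a3 $$ (n, v) * wedge1 i [i,j,k,l] u
      - of_bool (v = u) * (\<Sum>t<r3. a3 $$ (n, t) * wedge1 i [i,j,k,l] t)"
    using assms by (simp add: sum_subtractf sum_distrib_left[symmetric] sum_of_bool)
  finally show "(\<Sum>t<r3. a3 $$ (n, t) * (\<Sum>h<r2. a3 $$ (h, v) * w221 [i,j,k,l] i h t u))
    = (\<Sum>t<r3. a3 $$ (n, t) * (of_bool (v = t) * wedge1 i [i,j,k,l] u - of_bool (v = u) * wedge1 i [i,j,k,l] t))"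
    using assms n by (simp add: a3_w221_contract a2_a3 w2_a3 a3_wedge1 algebra_simps)
qed

text \<open>By \<open>a2_w3\<close>, the image of \<open>w3 [a,b,c]\<close> under \<open>a2\<close>
  is supported on the indices \<open>a\<close>, \<open>b\<close>, \<open>c\<close>; for these
  \<open>y\<close> the list \<open>[i,j,k,l,y]\<close> has a repetition.\<close>

lemma w321_term:
  assumes "i < r1" "j < r1" "k < r1" "l < r1" "n < r2" "u < r3" "a < r1" "b < r1" "c < r1"
    and "{a, b, c} \<subseteq> {i, j, k, l}"
  shows "(\<Sum>y<r1. (\<Sum>h<r2. a2 $$ (y, h) * w3 [a,b,c] h) * w321 [i,j,k,l,y] i n u) = 0"
proof (rule sum.neutral, rule ballI)
  fix y assume y: "y \<in> {..<r1}"
  show "(\<Sum>h<r2. a2 $$ (y, h) * w3 [a,b,c] h) * w321 [i,j,k,l,y] i n u = 0"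
  proof (cases "y \<in> {i, j, k, l}")
    case True
    then have "w321 [i,j,k,l,y] i n u = 0"
      using w321_alt[of i n u] y assms by (auto simp: alternating_def)
    then show ?thesis by simp
  next
    case False
    then show ?thesis
      using y assms by (auto simp: a2_w3)
  qed
qed

text \<open>Of the three \<open>w2\<close> contractions only the one with the pair i, l survives,
  and it cancels the \<open>wedge1\<close> term because \<open>[i,l,j,k]\<close> is an even
  rearrangement of \<open>[i,j,k,l]\<close>.\<close>

lemma w221_w3_zero:
  assumes "i < r1" "j < r1" "k < r1" "l < r1" "t < r3" "u < r3"
  shows "(\<Sum>h<r2. w3 [i,j,k] h * w221 [i,j,k,l] i h t u) = 0"
proof -
  have "(\<Sum>t<r3. a3 $$ (n, t) * (\<Sum>h<r2. w3 [i,j,k] h * w221 [i,j,k,l] i h t u)) = 0" if n: "n < r2" for n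
  proof -
    have "(\<Sum>h<r2. w3 [i,j,k] h * w2 [i,k] h u) = - (\<Sum>h<r2. w3 [i,k,j] h * w2 [i,k] h u)"
      unfolding sum_negf[symmetric] by (rule sum.cong) (use w3_perm(2)[of _ i j k] assms in simp_all)
    then have "(\<Sum>h<r2. w3 [i,j,k] h * w2 [i,k] h u) = 0"
      using w2_w3[of i k j u] assms by simp
    moreover have "wedge1 i [i,l,j,k] u = wedge1 i [i,j,k,l] u"
      using w1_swap_wedge1(2)[of i j l k u i] w1_swap_wedge1(3)[of i j k l u i] assms by simp
    ultimately show ?thesis
      using assms n by (simp add: a3_w221_contract w2_w3 w2_w3_wedge1 w321_term)
  qed
  then show ?thesis
    using a3_inj[of "\<lambda>t. \<Sum>h<r2. w3 [i,j,k] h * w221 [i,j,k,l] i h t u"] assms by blast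
qed

text \<open>For the fixed list \<open>[0,1,2,3]\<close> the right-hand side is the minor of the
  linked first differential on the columns of \<gamma>_t and \<gamma>_u. After \<open>a3\<close>,
  four products of a \<open>w3\<close> with a \<open>wedge1\<close> remain; expanding the wedges
  groups them into the lifting condition of \<open>w1\<close>, once for each coordinate of
  F_0.\<close>

lemma w221_w3:
  assumes "i < r1" "j < r1" "k < r1" "l < r1" "t < r3" "u < r3"
  shows "(\<Sum>h<r2. w3 [j,k,l] h * w221 [i,j,k,l] i h t u)
    = w1 [i,j,k,l] 0 t * w1 [i,j,k,l] 1 u - w1 [i,j,k,l] 0 u * w1 [i,j,k,l] 1 t"
proof (rule a3_cancel[of "\<lambda>t. \<Sum>h<r2. w3 [j,k,l] h * w221 [i,j,k,l] i h t u", OF _ assms(5)])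
  fix n assume n: "n < r2"
  \<comment> \<open>Here and in the next two facts the index common to the triple and the pair is
    moved to the front of both, as \<open>w2_w3_wedge1\<close> requires.\<close>
  have l: "(\<Sum>h<r2. w3 [j,k,l] h * w2 [i,l] h u) = wedge1 l [l,i,j,k] u"
  proof -
    have "(\<Sum>h<r2. w3 [j,k,l] h * w2 [i,l] h u) = - (\<Sum>h<r2. w3 [l,j,k] h * w2 [l,i] h u)"
      unfolding sum_negf[symmetric]
      by (rule sum.cong) (use w3_perm(5)[of _ j k l] w2_perm[of _ u l i] assms in simp_all)
    then show ?thesis
      using assms by (simp only: w2_w3_wedge1) simp
  qed
  have k: "(\<Sum>h<r2. w3 [j,k,l] h * w2 [i,k] h u) = - wedge1 k [k,i,j,l] u"
  proof -
    have "(\<Sum>h<r2. w3 [j,k,l] h * w2 [i,k] h u) = (\<Sum>h<r2. w3 [k,j,l] h * w2 [k,i] h u)"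
      by (rule sum.cong) (use w3_perm(1)[of _ j k l] w2_perm[of _ u k i] assms in simp_all)
    then show ?thesis
      using assms by (simp only: w2_w3_wedge1)
  qed
  have j: "(\<Sum>h<r2. w3 [j,k,l] h * w2 [i,j] h u) = wedge1 j [j,i,k,l] u"
  proof -
    have "(\<Sum>h<r2. w3 [j,k,l] h * w2 [i,j] h u) = - (\<Sum>h<r2. w3 [j,k,l] h * w2 [j,i] h u)"
      unfolding sum_negf[symmetric]
      by (rule sum.cong) (use w2_perm[of _ u j i] assms in simp_all)
    then show ?thesis
      using assms by (simp only: w2_w3_wedge1) simp
  qed
  have p: "wedge1 l [l,i,j,k] u = - wedge1 l [i,j,k,l] u" "wedge1 k [k,i,j,l] u = wedge1 k [i,j,k,l] u"
      "wedge1 j [j,i,k,l] u = - wedge1 j [i,j,k,l] u"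
    using w1_swap_wedge1(1)[of i l j k u l] w1_swap_wedge1(2)[of i j l k u l] w1_swap_wedge1(3)[of i j k l u l]
      w1_swap_wedge1(1)[of i k j l u k] w1_swap_wedge1(2)[of i j k l u k] w1_swap_wedge1(1)[of i j k l u j]
      assms by simp_all
  let ?w = "w1 [i,j,k,l]"
  have "(\<Sum>t<r3. a3 $$ (n, t) * (\<Sum>h<r2. w3 [j,k,l] h * w221 [i,j,k,l] i h t u))
    = w3 [i,j,k] n * - wedge1 l [i,j,k,l] u + w3 [i,j,l] n * wedge1 k [i,j,k,l] u
      - w3 [i,k,l] n * wedge1 j [i,j,k,l] u + w3 [j,k,l] n * wedge1 i [i,j,k,l] u"
    using assms n by (simp add: a3_w221_contract l k j p w321_term)
  also have "\<dots> = (\<Sum>t<r3. a3 $$ (n, t) * ?w 0 t) * ?w 1 u - ?w 0 u * (\<Sum>t<r3. a3 $$ (n, t) * ?w 1 t)"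
    using assms n by (simp add: a3_w1 wedge1_def algebra_simps)
  also have "\<dots> = (\<Sum>t<r3. a3 $$ (n, t) * (?w 0 t * ?w 1 u - ?w 0 u * ?w 1 t))"
    by (simp add: sum_distrib_left sum_distrib_right sum_subtractf algebra_simps)
  finally show "(\<Sum>t<r3. a3 $$ (n, t) * (\<Sum>h<r2. w3 [j,k,l] h * w221 [i,j,k,l] i h t u))
    = (\<Sum>t<r3. a3 $$ (n, t) * (?w 0 t * ?w 1 u - ?w 0 u * ?w 1 t))" .
qed

text \<open>After \<open>a3\<close>, the \<open>w1\<close> factors are contracted by
  \<open>a2_w1\<close> and the \<open>w3\<close> factor by the definition of \<open>w2\<close>. The
  sums \<open>S i\<close> and \<open>S j\<close> over \<open>w321\<close> stay unevaluated: the
  conditions for \<open>w221\<close> with leading index \<open>i\<close> and \<open>j\<close>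
  contain the same sums.\<close>

lemma a2_w121:
  assumes w121: "is_w1_21 a1 a3 w3 w1 w321 w121"
    and "i < r1" "j < r1" "k < r1" "l < r1" "c < 2" "n < r2" "t < r3" "u < r3"
  shows "(\<Sum>x<r1. a2 $$ (x, n) * w121 [i,j,k,l,x] [i,j] c t u) =
    a1 $$ (c, i) * w221 [j,i,k,l] j n t u + a1 $$ (c, j) * w221 [i,j,k,l] i n t u
    + w1 [i,j,k,l] c t * w2 [i,j] n u - w1 [i,j,k,l] c u * w2 [i,j] n t"
proof (rule a3_cancel[of "\<lambda>t. \<Sum>x<r1. a2 $$ (x, n) * w121 [i,j,k,l,x] [i,j] c t u", OF _ assms(8)])
  fix p assume p: "p < r2"
  have a3_w121: "(\<Sum>t<r3. a3 $$ (p, t) * w121 [i,j,k,l,x] [i,j] c t u) =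
      w3 [i,j,k] p * w1 [i,j,l,x] c u - w3 [i,j,l] p * w1 [i,j,k,x] c u
          + w3 [i,j,x] p * w1 [i,j,k,l] c u
          - a1 $$ (c, i) * w321 [i,j,k,l,x] j p u + a1 $$ (c, j) * w321 [i,j,k,l,x] i p u" if "x < r1" for x
    using w121 assms(2-) dims that p by (auto simp: is_w1_21_def Let_def iota_def)
  define S where "S y = (\<Sum>x<r1. a2 $$ (x, n) * w321 [i,j,k,l,x] y p u)" for y
  have Sj: "(\<Sum>x<r1. a2 $$ (x, n) * w321 [j,i,k,l,x] j p u) = - S j"
    unfolding S_def sum_negf[symmetric]
    by (rule sum.cong) (use w321_swap(1)[of j p u i j k l] p assms in simp_all)
  have a2w3: "(\<Sum>x<r1. a2 $$ (x, n) * w3 [i,j,x] p)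
      = minor a1 i j * of_bool (p = n) - (\<Sum>t<r3. a3 $$ (p, t) * w2 [i,j] n t)"
    using a3_w2[of i j n p] w3_perm(5)[of p i j] p assms by simp
  have "(\<Sum>t<r3. a3 $$ (p, t) * (\<Sum>x<r1. a2 $$ (x, n) * w121 [i,j,k,l,x] [i,j] c t u))
    = (\<Sum>x<r1. w3 [i,j,k] p * (a2 $$ (x, n) * w1 [i,j,l,x] c u) - w3 [i,j,l] p * (a2 $$ (x, n) * w1 [i,j,k,x] c u)
          + (a2 $$ (x, n) * w3 [i,j,x] p) * w1 [i,j,k,l] c u
          - a1 $$ (c, i) * (a2 $$ (x, n) * w321 [i,j,k,l,x] j p u)
          + a1 $$ (c, j) * (a2 $$ (x, n) * w321 [i,j,k,l,x] i p u))"
    by (simp add: sum_swap_mult a3_w121 algebra_simps)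
  also have "\<dots> = - w3 [i,j,k] p * (a1 $$ (c, i) * w2 [j,l] n u - a1 $$ (c, j) * w2 [i,l] n u + a1 $$ (c, l) * w2 [i,j] n u)
    + w3 [i,j,l] p * (a1 $$ (c, i) * w2 [j,k] n u - a1 $$ (c, j) * w2 [i,k] n u + a1 $$ (c, k) * w2 [i,j] n u)
    + (minor a1 i j * of_bool (p = n) - (\<Sum>t<r3. a3 $$ (p, t) * w2 [i,j] n t)) * w1 [i,j,k,l] c u
    - a1 $$ (c, i) * S j + a1 $$ (c, j) * S i"
    using assms(2-) by (simp add: sum.distrib sum_subtractf sum_distrib_left[symmetric]
      sum_distrib_right[symmetric] a2_w1 a2w3 S_def) (simp add: algebra_simps)
  finally have L: "(\<Sum>t<r3. a3 $$ (p, t) * (\<Sum>x<r1. a2 $$ (x, n) * w121 [i,j,k,l,x] [i,j] c t u)) = \<dots>" .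
  have "(\<Sum>t<r3. a3 $$ (p, t) * (a1 $$ (c, i) * w221 [j,i,k,l] j n t u + a1 $$ (c, j) * w221 [i,j,k,l] i n t u
      + w1 [i,j,k,l] c t * w2 [i,j] n u - w1 [i,j,k,l] c u * w2 [i,j] n t))
    = (\<Sum>t<r3. a1 $$ (c, i) * (a3 $$ (p, t) * w221 [j,i,k,l] j n t u)
      + a1 $$ (c, j) * (a3 $$ (p, t) * w221 [i,j,k,l] i n t u)
      + (a3 $$ (p, t) * w1 [i,j,k,l] c t) * w2 [i,j] n u - w1 [i,j,k,l] c u * (a3 $$ (p, t) * w2 [i,j] n t))"
    by (rule sum.cong) (simp_all add: algebra_simps)
  also have "\<dots> = a1 $$ (c, i) * (\<Sum>t<r3. a3 $$ (p, t) * w221 [j,i,k,l] j n t u)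
      + a1 $$ (c, j) * (\<Sum>t<r3. a3 $$ (p, t) * w221 [i,j,k,l] i n t u)
      + (\<Sum>t<r3. a3 $$ (p, t) * w1 [i,j,k,l] c t) * w2 [i,j] n u
      - w1 [i,j,k,l] c u * (\<Sum>t<r3. a3 $$ (p, t) * w2 [i,j] n t)"
    by (simp add: sum.distrib sum_subtractf sum_distrib_left sum_distrib_right)
  also have "\<dots> = a1 $$ (c, i) * (- w3 [i,j,k] p * w2 [j,l] n u + w3 [i,j,l] p * w2 [j,k] n u
        + w3 [j,k,l] p * - w2 [i,j] n u - of_bool (p = n) * wedge1 j [i,j,k,l] u - S j)
      + a1 $$ (c, j) * (w3 [i,j,k] p * w2 [i,l] n u - w3 [i,j,l] p * w2 [i,k] n u
        + w3 [i,k,l] p * w2 [i,j] n u + of_bool (p = n) * wedge1 i [i,j,k,l] u + S i)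
      + (a1 $$ (c, i) * w3 [j,k,l] p - a1 $$ (c, j) * w3 [i,k,l] p
        + a1 $$ (c, k) * w3 [i,j,l] p - a1 $$ (c, l) * w3 [i,j,k] p) * w2 [i,j] n u
      - w1 [i,j,k,l] c u * (\<Sum>t<r3. a3 $$ (p, t) * w2 [i,j] n t)"
    using assms(2-) p w1_swap_wedge1(1)[of i j k l u j] w2_perm[of n u i j]
      w3_perm(1)[of p i j k] w3_perm(1)[of p i j l]
    by (simp only: a3_w221 a3_w1 Sj S_def[symmetric]) simp
  also have "\<dots> = - w3 [i,j,k] p * (a1 $$ (c, i) * w2 [j,l] n u - a1 $$ (c, j) * w2 [i,l] n u + a1 $$ (c, l) * w2 [i,j] n u)
    + w3 [i,j,l] p * (a1 $$ (c, i) * w2 [j,k] n u - a1 $$ (c, j) * w2 [i,k] n u + a1 $$ (c, k) * w2 [i,j] n u)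
    + (minor a1 i j * of_bool (p = n) - (\<Sum>t<r3. a3 $$ (p, t) * w2 [i,j] n t)) * w1 [i,j,k,l] c u
    - a1 $$ (c, i) * S j + a1 $$ (c, j) * S i"
  proof -
    \<comment> \<open>The terms at \<open>p = n\<close> agree by Cramer's rule: the minor on columns
      i, j times a vector of F_0 is recovered from its wedges with a1(e_i) and a1(e_j).\<close>
    have "c = 0 \<or> c = 1" using assms by linarith
    then show ?thesis by (auto simp: minor_def wedge1_def algebra_simps)
  qed
  finally show "(\<Sum>t<r3. a3 $$ (p, t) * (\<Sum>x<r1. a2 $$ (x, n) * w121 [i,j,k,l,x] [i,j] c t u)) =
    (\<Sum>t<r3. a3 $$ (p, t) * (a1 $$ (c, i) * w221 [j,i,k,l] j n t u + a1 $$ (c, j) * w221 [i,j,k,l] i n t u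
      + w1 [i,j,k,l] c t * w2 [i,j] n u - w1 [i,j,k,l] c u * w2 [i,j] n t))"
    using L by simp
qed

end

section \<open>The same contractions with the common indices in other positions\<close>

context structure_maps
begin

lemma wedge1_alt: "t < r3 \<Longrightarrow> alternating r1 4 (\<lambda>xs. wedge1 p xs t)"
  using w1_alt[of 0 t] w1_alt[of 1 t] by (auto simp: wedge1_def alternating_def)

lemma w2_w3_perm:
  assumes "i < r1" "j < r1" "p < r1" "t < r3"
  shows "(\<Sum>h<r2. w3 [i,p,j] h * w2 [i,j] h t) = 0" "(\<Sum>h<r2. w3 [p,i,j] h * w2 [i,j] h t) = 0"
proof -
  have "(\<Sum>h<r2. w3 [i,p,j] h * w2 [i,j] h t) = - (\<Sum>h<r2. w3 [i,j,p] h * w2 [i,j] h t)"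
    unfolding sum_negf[symmetric]
    by (rule sum.cong) (use w3_perm(2)[of _ i j p] assms in simp_all)
  moreover have "(\<Sum>h<r2. w3 [p,i,j] h * w2 [i,j] h t) = (\<Sum>h<r2. w3 [i,j,p] h * w2 [i,j] h t)"
    by (rule sum.cong) (use w3_perm(5)[of _ i j p] assms in simp_all)
  ultimately show "(\<Sum>h<r2. w3 [i,p,j] h * w2 [i,j] h t) = 0" "(\<Sum>h<r2. w3 [p,i,j] h * w2 [i,j] h t) = 0"
    using assms by (simp_all add: w2_w3)
qed

text \<open>\<open>beta2\<close> evaluates \<open>w3\<close> on increasing triples, so the common
  index may stand anywhere in the triple and may be either member of the pair.\<close>

lemma w2_w3_wedge1_perm:
  assumes "i < r1" "j < r1" "p < r1" "q < r1" "t < r3"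
  shows "(\<Sum>h<r2. w3 [p,i,q] h * w2 [i,j] h t) = wedge1 i [i,j,p,q] t"
    "(\<Sum>h<r2. w3 [p,q,i] h * w2 [i,j] h t) = - wedge1 i [i,j,p,q] t"
    "(\<Sum>h<r2. w3 [j,p,q] h * w2 [i,j] h t) = - wedge1 j [i,j,p,q] t"
    "(\<Sum>h<r2. w3 [p,j,q] h * w2 [i,j] h t) = wedge1 j [i,j,p,q] t"
    "(\<Sum>h<r2. w3 [p,q,j] h * w2 [i,j] h t) = - wedge1 j [i,j,p,q] t"
proof -
  have *: "(\<Sum>h<r2. w3 [p,i,q] h * w2 [i,j] h t) = wedge1 i [i,j,p,q] t"
    "(\<Sum>h<r2. w3 [p,q,i] h * w2 [i,j] h t) = - wedge1 i [i,j,p,q] t" if "i < r1" "j < r1" for i j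
  proof -
    have "(\<Sum>h<r2. w3 [p,i,q] h * w2 [i,j] h t) = - (\<Sum>h<r2. w3 [i,p,q] h * w2 [i,j] h t)"
      unfolding sum_negf[symmetric]
      by (rule sum.cong) (use w3_perm(1)[of _ i p q] assms that in simp_all)
    moreover have "(\<Sum>h<r2. w3 [p,q,i] h * w2 [i,j] h t) = (\<Sum>h<r2. w3 [i,p,q] h * w2 [i,j] h t)"
      by (rule sum.cong) (use w3_perm(4)[of _ i p q] assms that in simp_all)
    ultimately show "(\<Sum>h<r2. w3 [p,i,q] h * w2 [i,j] h t) = wedge1 i [i,j,p,q] t"
      "(\<Sum>h<r2. w3 [p,q,i] h * w2 [i,j] h t) = - wedge1 i [i,j,p,q] t"
      using assms that by (simp_all add: w2_w3_wedge1)
  qed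
  have sw: "(\<Sum>h<r2. w3 xs h * w2 [i,j] h t) = - (\<Sum>h<r2. w3 xs h * w2 [j,i] h t)" for xs
    unfolding sum_negf[symmetric] by (rule sum.cong) (use w2_perm[of _ t j i] assms in simp_all)
  show "(\<Sum>h<r2. w3 [p,i,q] h * w2 [i,j] h t) = wedge1 i [i,j,p,q] t"
    "(\<Sum>h<r2. w3 [p,q,i] h * w2 [i,j] h t) = - wedge1 i [i,j,p,q] t"
    using * assms by auto
  show "(\<Sum>h<r2. w3 [j,p,q] h * w2 [i,j] h t) = - wedge1 j [i,j,p,q] t"
    "(\<Sum>h<r2. w3 [p,j,q] h * w2 [i,j] h t) = wedge1 j [i,j,p,q] t"
    "(\<Sum>h<r2. w3 [p,q,j] h * w2 [i,j] h t) = - wedge1 j [i,j,p,q] t"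
    unfolding sw using *[of j i] w1_swap_wedge1(1)[of i j p q t j] assms
    by (simp_all add: w2_w3_wedge1)
qed

end

text \<open>Permuting the last three arguments of \<open>w221\<close> reduces every pair to j, k.
  For 0, 1, 2, 3 this settles the three increasing triples that contain the distinguished
  index.\<close>

lemma (in structure_maps_21) w221_w3_zero_perm:
  assumes "i < r1" "j < r1" "k < r1" "l < r1" "t < r3" "u < r3"
    and ab: "(a, b) \<in> {(j, k), (j, l), (k, l)}"
  shows "(\<Sum>h<r2. w3 [i,a,b] h * w221 [i,j,k,l] i h t u) = 0"
    "(\<Sum>h<r2. w3 [a,i,b] h * w221 [i,j,k,l] i h t u) = 0"
    "(\<Sum>h<r2. w3 [a,b,i] h * w221 [i,j,k,l] i h t u) = 0"
proof -
  have "(\<Sum>h<r2. w3 [i,j,l] h * w221 [i,j,k,l] i h t u) = - (\<Sum>h<r2. w3 [i,j,l] h * w221 [i,j,l,k] i h t u)"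
    unfolding sum_negf[symmetric]
    by (rule sum.cong) (use w221_swap(3)[of i _ t u i j l k] assms in simp_all)
  moreover have "(\<Sum>h<r2. w3 [i,k,l] h * w221 [i,j,k,l] i h t u) = (\<Sum>h<r2. w3 [i,k,l] h * w221 [i,k,l,j] i h t u)"
    by (rule sum.cong) (use alternating4_perm(5)[OF w221_alt, of i _ t u i k l j] assms in simp_all)
  ultimately show *: "(\<Sum>h<r2. w3 [i,a,b] h * w221 [i,j,k,l] i h t u) = 0"
    using assms by (auto simp: w221_w3_zero)
  have lt: "a < r1" "b < r1" using assms by auto
  have "(\<Sum>h<r2. w3 [a,i,b] h * w221 [i,j,k,l] i h t u) = - (\<Sum>h<r2. w3 [i,a,b] h * w221 [i,j,k,l] i h t u)"
    unfolding sum_negf[symmetric]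
    by (rule sum.cong) (use w3_perm(1)[of _ i a b] assms lt in simp_all)
  with * show "(\<Sum>h<r2. w3 [a,i,b] h * w221 [i,j,k,l] i h t u) = 0" by simp
  have "(\<Sum>h<r2. w3 [a,b,i] h * w221 [i,j,k,l] i h t u) = (\<Sum>h<r2. w3 [i,a,b] h * w221 [i,j,k,l] i h t u)"
    by (rule sum.cong) (use w3_perm(4)[of _ i a b] assms lt in simp_all)
  with * show "(\<Sum>h<r2. w3 [a,b,i] h * w221 [i,j,k,l] i h t u) = 0" by simp
qed

lemma less4: "i < (4::nat) \<longleftrightarrow> i = 0 \<or> i = 1 \<or> i = 2 \<or> i = 3"
  by auto

lemma less4_pairs:
  "i < j \<and> j < (4::nat) \<longleftrightarrow>
    (i, j) \<in> {(0, 1), (0, 2), (0, 3), (1, 2), (1, 3), (2, 3)}"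
  by auto

lemma less4_triples:
  "i < j \<and> j < k \<and> k < (4::nat) \<longleftrightarrow> (i, j, k) \<in> {(0, 1, 2), (0, 1, 3), (0, 2, 3), (1, 2, 3)}"
  by auto

text \<open>D_3 keeps only the \<epsilon>_k with k >= 4, whereas the contractions run over all of
  F_1.\<close>

lemma sum_from4:
  fixes f :: "nat \<Rightarrow> 'a::comm_ring_1"
  assumes "4 \<le> r"
  shows "(\<Sum>k<r - 4. f (k + 4)) = (\<Sum>k<r. f k) - f 0 - f 1 - f 2 - f 3"
proof -
  have "(\<Sum>k<r. f k) = (\<Sum>k<4. f k) + (\<Sum>k=4..<r. f k)"
    using assms by (simp add: sum.atLeastLessThan_concat lessThan_atLeast0)
  moreover have "(\<Sum>k=4..<r. f k) = (\<Sum>k<r - 4. f (k + 4))"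
    using sum.shift_bounds_nat_ivl[of f 0 4 "r - 4"] assms by (simp add: lessThan_atLeast0)
  ultimately show ?thesis
    by (simp add: numeral_eq_Suc)
qed

subsection \<open>The structure maps of the linked complex\<close>

locale linked_structure_maps = structure_maps_21 +
  fixes w121 :: "nat list \<Rightarrow> nat list \<Rightarrow> nat \<Rightarrow> nat \<Rightarrow> nat \<Rightarrow> 'a"
  assumes r1_ge: "4 \<le> r1" and r3_le: "r3 \<le> 2"
    and w121: "r3 = 2 \<Longrightarrow> is_w1_21 a1 a3 w3 w1 w321 w121"
begin

text \<open>Keeps the index 1 from becoming \<open>Suc 0\<close>, so that rules about
  \<open>[0,1,2,3]\<close> still match.\<close>

declare One_nat_def [simp del]

lemma lt4: "0 < r1" "1 < r1" "2 < r1" "3 < r1" "i < 4 \<Longrightarrow> i < r1"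
  using r1_ge by simp_all

abbreviation d1 where "d1 \<equiv> linked_d1 a1 a3 w1"
abbreviation d2 where "d2 \<equiv> linked_d2 a3 w3"
abbreviation d3 where "d3 \<equiv> linked_d3 a2"

lemma d_dims: "dim_col d1 = r3 + 4" "dim_col d2 = r2" "dim_row d3 = r2" "dim_col d3 = r1 - 4"
  using dims by (auto simp: linked_d1_def linked_d2_def linked_d3_def Let_def)

lemma d1_entries:
  "c < 2 \<Longrightarrow> t < r3 \<Longrightarrow> d1 $$ (c, t) = - w1 [0,1,2,3] c t"
  "c < 2 \<Longrightarrow> i < 4 \<Longrightarrow> d1 $$ (c, r3 + i) = a1 $$ (c, i)"
  using dims by (auto simp: linked_d1_def beta3_def Let_def)

lemma d2_entries:
  "n < r3 \<Longrightarrow> h < r2 \<Longrightarrow> d2 $$ (n, h) = a3 $$ (h, n)"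
  "l < 4 \<Longrightarrow> h < r2 \<Longrightarrow> d2 $$ (r3 + l, h) = beta2 w3 l h"
  using dims by (auto simp: linked_d2_def Let_def)

lemma d3_entries: "h < r2 \<Longrightarrow> k < r1 - 4 \<Longrightarrow> d3 $$ (h, k) = - a2 $$ (k + 4, h)"
  using dims by (auto simp: linked_d3_def)

text \<open>The minus sign in front of \<open>beta3\<close> gives the mixed minors the sign of
  \<open>wedge1\<close>, and it cancels in the minors on two \<gamma>'s.\<close>

lemma minor_d1:
  "i < 4 \<Longrightarrow> j < 4 \<Longrightarrow> minor d1 (r3 + i) (r3 + j) = minor a1 i j"
  "t < r3 \<Longrightarrow> i < 4 \<Longrightarrow> minor d1 t (r3 + i) = wedge1 i [0,1,2,3] t"
  "t < r3 \<Longrightarrow> u < r3 \<Longrightarrow>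
    minor d1 t u = w1 [0,1,2,3] 0 t * w1 [0,1,2,3] 1 u - w1 [0,1,2,3] 0 u * w1 [0,1,2,3] 1 t"
  by (simp_all add: minor_def wedge1_def d1_entries)

lemmas wedge1_std = alternating4_perm[OF wedge1_alt lt4(1-4)]
lemmas w1_std = alternating4_perm[OF w1_alt lt4(1-4)]
lemmas w221_std = alternating4_perm[OF w221_alt lt4(1-4)]

text \<open>Row \<open>l\<close> of \<open>beta2\<close> is, up to sign, \<open>w3\<close> on the
  triple omitting \<open>l\<close>. The triple contains both i and j unless \<open>l\<close> is one
  of them, and then it shares exactly the other one.\<close>

lemma beta2_w2:
  assumes "i < j" "j < 4" "l < 4" "t < r3"
  shows "(\<Sum>h<r2. beta2 w3 l h * w2 [i,j] h t)
    = of_bool (l = j) * wedge1 i [0,1,2,3] t - of_bool (l = i) * wedge1 j [0,1,2,3] t"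
proof -
  note z = w2_w3[OF _ _ _ assms(4)] w2_w3_perm[OF _ _ _ assms(4)]
  note w = w2_w3_wedge1[OF _ _ _ _ assms(4)] w2_w3_wedge1_perm[OF _ _ _ _ assms(4)]
  have "(i, j) \<in> {(0, 1), (0, 2), (0, 3), (1, 2), (1, 3), (2, 3)}"
    using assms less4_pairs by blast
  then show ?thesis
    using assms(3) unfolding less4
    by (elim insertE disjE; simp add: beta2_def sum_negf)
      (simp_all add: z lt4 sum_negf, simp_all add: w lt4 wedge1_std[OF assms(4)])
qed

lemma w221_head:
  assumes "h < r2" "t < r3" "u < r3"
  shows "w221 [0,1,2,3] 1 h t u = - w221 [1,0,2,3] 1 h t u"
    "w221 [0,1,2,3] 2 h t u = w221 [2,0,1,3] 2 h t u"
    "w221 [0,1,2,3] 3 h t u = - w221 [3,0,1,2] 3 h t u"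
  using w221_std(1)[of 1] w221_std(2)[of 2] w221_std(3)[of 3] assms lt4 by simp_all

lemma sum_w221_head:
  assumes "t < r3" "u < r3"
  shows "(\<Sum>h<r2. x h * w221 [0,1,2,3] 1 h t u) = - (\<Sum>h<r2. x h * w221 [1,0,2,3] 1 h t u)"
    "(\<Sum>h<r2. x h * w221 [0,1,2,3] 2 h t u) = (\<Sum>h<r2. x h * w221 [2,0,1,3] 2 h t u)"
    "(\<Sum>h<r2. x h * w221 [0,1,2,3] 3 h t u) = - (\<Sum>h<r2. x h * w221 [3,0,1,2] 3 h t u)"
proof -
  show "(\<Sum>h<r2. x h * w221 [0,1,2,3] 1 h t u) = - (\<Sum>h<r2. x h * w221 [1,0,2,3] 1 h t u)"
    unfolding sum_negf[symmetric] using assms by (intro sum.cong) (simp_all add: w221_head)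
  show "(\<Sum>h<r2. x h * w221 [0,1,2,3] 2 h t u) = (\<Sum>h<r2. x h * w221 [2,0,1,3] 2 h t u)"
    using assms by (intro sum.cong) (simp_all add: w221_head)
  show "(\<Sum>h<r2. x h * w221 [0,1,2,3] 3 h t u) = - (\<Sum>h<r2. x h * w221 [3,0,1,2] 3 h t u)"
    unfolding sum_negf[symmetric] using assms by (intro sum.cong) (simp_all add: w221_head)
qed

text \<open>\<open>is_w2_21\<close> grants skew-symmetry when the distinguished index leads the
  list, so it is first brought there.\<close>

lemma w221_std_skew:
  assumes "i < 4" "h < r2" "t < r3" "u < r3"
  shows "w221 [0,1,2,3] i h u t = - w221 [0,1,2,3] i h t u"
proof -
  have "w221 [i,j,k,l] i h u t = - w221 [i,j,k,l] i h t u"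
    if "i < r1" "j < r1" "k < r1" "l < r1" for i j k l
    using w221_skew[OF that assms(2)] assms(3,4) unfolding skew_def by blast
  from this[of 0 1 2 3] this[of 1 0 2 3] this[of 2 0 1 3] this[of 3 0 1 2] show ?thesis
    using assms lt4 unfolding less4 by (elim disjE; simp add: w221_head)
qed

lemma w221_std_a3:
  assumes "i < 4" "t < r3" "u < r3" "v < r3"
  shows "(\<Sum>h<r2. a3 $$ (h, v) * w221 [0,1,2,3] i h t u)
    = of_bool (v = t) * wedge1 i [0,1,2,3] u - of_bool (v = u) * wedge1 i [0,1,2,3] t"
  using assms(1) assms(2-) lt4 wedge1_std[of t] wedge1_std[of u]
  by (auto simp: less4 sum_w221_head w221_a3)

text \<open>The triple of row \<open>l\<close> avoids the distinguished index \<open>i\<close>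
  exactly when \<open>l = i\<close>: \<open>w221_w3\<close> applies then, and
  \<open>w221_w3_zero_perm\<close> otherwise.\<close>

lemma beta2_w221:
  assumes "i < 4" "l < 4" "t < r3" "u < r3"
  shows "(\<Sum>h<r2. beta2 w3 l h * w221 [0,1,2,3] i h t u) = of_bool (l = i) *
    (w1 [0,1,2,3] 0 t * w1 [0,1,2,3] 1 u - w1 [0,1,2,3] 0 u * w1 [0,1,2,3] 1 t)"
  using assms(1,2) unfolding less4
  by (elim disjE; simp add: beta2_def sum_negf assms sum_w221_head lt4 w221_w3 w221_w3_zero_perm;
      simp add: w1_std assms)

text \<open>
  The values on increasing lists, in which the \<open>\<gamma>\<^sub>t\<close> (indices below \<open>r3\<close>) come first. The basis element
  of \<open>B\<^sub>1\<close> missing from \<open>s\<^sub>i \<and> s\<^sub>j \<and> s\<^sub>k\<close> has the index \<open>6 - (i + j + k)\<close>.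
\<close>

definition linked_w3_sorted :: "nat \<Rightarrow> nat list \<Rightarrow> 'a" where
  "linked_w3_sorted h xs = (let a = xs ! 0; b = xs ! 1; c = xs ! 2 in
     if r3 \<le> a then (let r = 6 - (a - r3 + (b - r3) + (c - r3)) in (- 1) ^ Suc r * a2 $$ (r, h))
     else if r3 \<le> b then w2 [b - r3, c - r3] h a
     else w221 [0,1,2,3] (c - r3) h a b)"

definition linked_w3 :: "nat list \<Rightarrow> nat \<Rightarrow> 'a" where
  "linked_w3 xs h = alt_ext (linked_w3_sorted h) xs"

lemma linked_w3_eqs:
  "i < j \<Longrightarrow> j < k \<Longrightarrow> linked_w3 [r3 + i, r3 + j, r3 + k] h
    = (- 1) ^ Suc (6 - (i + j + k)) * a2 $$ (6 - (i + j + k), h)"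
  "i < j \<Longrightarrow> t < r3 \<Longrightarrow> linked_w3 [t, r3 + i, r3 + j] h = w2 [i,j] h t"
  "t < u \<Longrightarrow> u < r3 \<Longrightarrow> linked_w3 [t, u, r3 + i] h = w221 [0,1,2,3] i h t u"
  by (simp_all add: linked_w3_def alt_ext_sorted linked_w3_sorted_def Let_def)

lemma linked_w3_alt: "alternating n p (\<lambda>xs. linked_w3 xs h)"
  unfolding linked_w3_def by (rule alternating_alt_ext)

lemma w3_a2:
  assumes "i < r1" "j < r1" "k < r1" "n < r1"
  shows "(\<Sum>h<r2. w3 [i,j,k] h * a2 $$ (n, h)) = minor a1 i j * of_bool (n = k)
    - minor a1 i k * of_bool (n = j) + minor a1 j k * of_bool (n = i)"
  using a2_w3[OF assms] by (simp add: mult.commute)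

text \<open>Six cases: three kinds of increasing triples, each tested on the rows \<gamma>_n
  (contraction with \<open>a3\<close>) and the rows s_l (contraction with
  \<open>beta2\<close>).\<close>

lemma is_w3_linked: "is_w3_1 d1 d2 linked_w3"
proof -
  have "(\<Sum>h<r2. d2 $$ (n, h) * linked_w3 [a, b, c] h) = minor d1 a b * of_bool (n = c)
      - minor d1 a c * of_bool (n = b) + minor d1 b c * of_bool (n = a)"
    if "a < b" "b < c" "c < r3 + 4" "n < r3 + 4" for a b c n
  proof -
    have n: "n < r3 \<or> (\<exists>l<4. n = r3 + l)"
      using that(4) by presburger
    consider (sss) i j k where "a = r3 + i" "b = r3 + j" "c = r3 + k" "i < j" "j < k" "k < 4"
      | (gss) i j where "a < r3" "b = r3 + i" "c = r3 + j" "i < j" "j < 4"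
      | (ggs) i where "b < r3" "c = r3 + i" "i < 4"
    proof -
      consider "r3 \<le> a" | "a < r3" "r3 \<le> b" | "b < r3" "r3 \<le> c"
        using \<open>a < b\<close> \<open>b < c\<close> r3_le by linarith
      then show thesis
        using sss[of "a - r3" "b - r3" "c - r3"] gss[of "b - r3" "c - r3"] ggs[of "c - r3"]
          \<open>a < b\<close> \<open>b < c\<close> \<open>c < r3 + 4\<close>
        by cases auto
    qed
    then show ?thesis
    proof cases
      case sss
      then have "(i, j, k) \<in> {(0, 1, 2), (0, 1, 3), (0, 2, 3), (1, 2, 3)}"
        using less4_triples by blast
      then have "(\<Sum>h<r2. beta2 w3 l h * ((- 1) ^ Suc (6 - (i + j + k)) * a2 $$ (6 - (i + j + k), h)))
          = minor a1 i j * of_bool (l = k) - minor a1 i k * of_bool (l = j) + minor a1 j k * of_bool (l = i)"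
        if "l < 4" for l
        using that unfolding less4
        by (elim insertE disjE; simp add: beta2_def sum_negf w3_a2 lt4)
      note beta2_a2 = this
      have g: "(\<Sum>h<r2. a3 $$ (h, n) * a2 $$ (x, h)) = 0" if "x < r1" "n < r3" for x
        using a2_a3[OF that] by (simp add: mult.commute)
      show ?thesis
        using n
      proof (elim disjE exE conjE)
        assume "n < r3"
        then have "(\<Sum>h<r2. d2 $$ (n, h) * (y * a2 $$ (x, h))) = 0" if "x < r1" for x y
          using g[OF that] by (simp add: d2_entries mult.left_commute[of _ y] sum_distrib_left[symmetric])
        then show ?thesis
          using sss \<open>n < r3\<close> lt4(5) r1_ge by (simp add: linked_w3_eqs sum_negf)
      next
        fix l assume "l < 4" and n: "n = r3 + l"
        then show ?thesis
          using sss beta2_a2[of l] by (simp add: linked_w3_eqs minor_d1 d2_entries)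
      qed
    next
      case gss
      show ?thesis
        using n gss lt4(5) r1_ge
        by (elim disjE exE conjE) (simp_all add: linked_w3_eqs minor_d1 d2_entries w2_a3 beta2_w2)
    next
      case ggs
      show ?thesis
        using n ggs lt4(5) r1_ge \<open>a < b\<close>
        by (elim disjE exE conjE) (simp_all add: linked_w3_eqs minor_d1 d2_entries w221_std_a3 beta2_w221)
    qed
  qed
  note sorted = this
  have "(\<Sum>h<r2. d2 $$ (n, h) * linked_w3 xs h) = minor d1 (xs ! 0) (xs ! 1) * of_bool (n = xs ! 2)
      - minor d1 (xs ! 0) (xs ! 2) * of_bool (n = xs ! 1) + minor d1 (xs ! 1) (xs ! 2) * of_bool (n = xs ! 0)"
    if "length xs = 3" "set xs \<subseteq> {..<r3 + 4}" "n < r3 + 4" for xs n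
    using that(1,2)
  proof (rule alternating_eq_sorted[rotated 2])
    show "alternating (r3 + 4) 3 (\<lambda>xs. \<Sum>h<r2. d2 $$ (n, h) * linked_w3 xs h)"
      by (rule alternating_sum) (rule linked_w3_alt)
  qed (auto simp: sorted that elim!: length3E intro: alternating_minor)
  from this[of "[_, _, _]"] show ?thesis
    by (auto simp: is_w3_1_def Let_def d_dims linked_w3_alt)
qed

end

section \<open>The lifting condition for \<open>w1\<close> of the linked complex\<close>

context linked_structure_maps
begin

text \<open>
  Moving \<open>\<gamma>\<^sub>t\<close> in front of three \<open>s\<close>'s is an odd permutation. The first value, not listed in the
  claim, is forced by \<open>a\<^sub>1 a\<^sub>2 = 0\<close>.
\<close>

definition linked_w1_sorted :: "nat \<Rightarrow> nat \<Rightarrow> nat list \<Rightarrow> 'a" where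
  "linked_w1_sorted c k xs = (let a = xs ! 0; b = xs ! 1; x = xs ! 2; y = xs ! 3 in
     if r3 \<le> a then - a1 $$ (c, k + 4)
     else if r3 \<le> b then - w1 [b - r3, x - r3, y - r3, k + 4] c a
     else w121 [0,1,2,3,k+4] [x - r3, y - r3] c a b)"

definition linked_w1 :: "nat list \<Rightarrow> nat \<Rightarrow> nat \<Rightarrow> 'a" where
  "linked_w1 xs c k = alt_ext (linked_w1_sorted c k) xs"

lemma linked_w1_eqs:
  "i < j \<Longrightarrow> j < l \<Longrightarrow> l < p \<Longrightarrow> linked_w1 [r3 + i, r3 + j, r3 + l, r3 + p] c k = - a1 $$ (c, k + 4)"
  "i < j \<Longrightarrow> j < l \<Longrightarrow> t < r3 \<Longrightarrow> linked_w1 [t, r3 + i, r3 + j, r3 + l] c k = - w1 [i,j,l,k + 4] c t"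
  "i < j \<Longrightarrow> t < u \<Longrightarrow> u < r3 \<Longrightarrow> linked_w1 [t, u, r3 + i, r3 + j] c k = w121 [0,1,2,3,k+4] [i,j] c t u"
  by (simp_all add: linked_w1_def alt_ext_sorted linked_w1_sorted_def Let_def)

lemma linked_w1_alt: "alternating n p (\<lambda>xs. linked_w1 xs c k)"
  unfolding linked_w1_def by (rule alternating_alt_ext)

lemma w1_repeated:
  assumes "i < r1" "j < r1" "l < r1" "k < r1" "c < 2" "t < r3" "\<not> distinct [i,j,l,k]"
  shows "w1 [i,j,l,k] c t = 0"
  using w1_alt[OF assms(5,6)] assms(1-4,7) unfolding alternating_def
  by (elim allE[of _ "[i,j,l,k]"]) auto

lemma sum_a2_from4:
  "(\<Sum>k<r1 - 4. a2 $$ (k + 4, n) * f (k + 4)) = (\<Sum>k<r1. a2 $$ (k, n) * f k)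
    - a2 $$ (0, n) * f 0 - a2 $$ (1, n) * f 1 - a2 $$ (2, n) * f 2 - a2 $$ (3, n) * f 3"
  using sum_from4[OF r1_ge, of "\<lambda>k. a2 $$ (k, n) * f k"] by simp

lemma w121_props:
  assumes "r3 = 2"
  shows "c < 2 \<Longrightarrow> t < r3 \<Longrightarrow> u < r3 \<Longrightarrow> p < r1 \<Longrightarrow> q < r1 \<Longrightarrow>
      alternating r1 5 (\<lambda>xs. w121 xs [p,q] c t u)"
    and "i < r1 \<Longrightarrow> j < r1 \<Longrightarrow> k < r1 \<Longrightarrow> l < r1 \<Longrightarrow> x < r1 \<Longrightarrow> c < 2 \<Longrightarrow> t < r3 \<Longrightarrow> u < r3 \<Longrightarrow>
      alternating r1 2 (\<lambda>ys. w121 [i,j,k,l,x] ys c t u)"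
    and "i < r1 \<Longrightarrow> j < r1 \<Longrightarrow> k < r1 \<Longrightarrow> l < r1 \<Longrightarrow> x < r1 \<Longrightarrow> p < r1 \<Longrightarrow> q < r1 \<Longrightarrow> c < 2 \<Longrightarrow>
      skew r3 (w121 [i,j,k,l,x] [p,q] c)"
  using w121[OF assms] dims by (auto simp: is_w1_21_def Let_def)

text \<open>Among the cut-off indices k < 4, those in the triple give a repetition. The fourth, 6 -
  (i + j + l), contributes the product of d1(\<gamma>_t) with the value on three s's;
  \<open>a2_w1\<close> supplies the other terms.\<close>

lemma linked_w1_gsss:
  assumes "i < j" "j < l" "l < 4" "c < 2" "n < r2" "t < r3"
  shows "(\<Sum>k<r1 - 4. d3 $$ (n, k) * linked_w1 [t, r3 + i, r3 + j, r3 + l] c k) =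
    d1 $$ (c, t) * linked_w3 [r3 + i, r3 + j, r3 + l] n - d1 $$ (c, r3 + i) * linked_w3 [t, r3 + j, r3 + l] n
    + d1 $$ (c, r3 + j) * linked_w3 [t, r3 + i, r3 + l] n - d1 $$ (c, r3 + l) * linked_w3 [t, r3 + i, r3 + j] n"
proof -
  let ?r = "6 - (i + j + l)"
  have ijl: "(i, j, l) \<in> {(0, 1, 2), (0, 1, 3), (0, 2, 3), (1, 2, 3)}"
    using less4_triples assms by blast
  have rep: "w1 [i,j,l,i] c t = 0" "w1 [i,j,l,j] c t = 0" "w1 [i,j,l,l] c t = 0"
    using assms lt4(5) by (simp_all add: w1_repeated)
  have "w1 [i,j,l,?r] c t = (- 1) ^ Suc ?r * w1 [0,1,2,3] c t"
    using ijl w1_swap(3)[OF assms(4,6) lt4(1,2,3,4)] w1_swap(3)[OF assms(4,6) lt4(1,3,2,4)]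
    by (elim insertE; simp add: w1_std assms flip: One_nat_def)
  moreover have "{0, 1, 2, 3} = {i, j, l, ?r}"
    using ijl by auto
  ultimately have "(\<Sum>k<r1 - 4. a2 $$ (k + 4, n) * w1 [i,j,l,k + 4] c t)
      = (\<Sum>k<r1. a2 $$ (k, n) * w1 [i,j,l,k] c t) - a2 $$ (?r, n) * ((- 1) ^ Suc ?r * w1 [0,1,2,3] c t)"
    unfolding sum_a2_from4[of n "\<lambda>k. w1 [i,j,l,k] c t"] using ijl rep
    by (elim insertE) (simp_all add: algebra_simps flip: One_nat_def)
  moreover have "(\<Sum>k<r1 - 4. d3 $$ (n, k) * linked_w1 [t, r3 + i, r3 + j, r3 + l] c k)
      = (\<Sum>k<r1 - 4. a2 $$ (k + 4, n) * w1 [i,j,l,k + 4] c t)"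
    using assms by (intro sum.cong) (simp_all add: d3_entries linked_w1_eqs)
  ultimately show ?thesis
    using assms lt4(5) by (simp add: a2_w1 d1_entries linked_w3_eqs)
qed

text \<open>\<open>a2_w121\<close> needs the pair i, j at the head of the list of five; the last
  entry, over which the sum runs, stays in place.\<close>

lemma a2_w121_std:
  assumes r3: "r3 = 2" and "i < j" "j < 4" "c < 2" "n < r2" "t < r3" "u < r3"
  shows "(\<Sum>x<r1. a2 $$ (x, n) * w121 [0,1,2,3,x] [i,j] c t u) =
    - a1 $$ (c, i) * w221 [0,1,2,3] j n t u + a1 $$ (c, j) * w221 [0,1,2,3] i n t u
    + w1 [0,1,2,3] c t * w2 [i,j] n u - w1 [0,1,2,3] c u * w2 [i,j] n t"
proof -
  have ij: "(i, j) \<in> {(0, 1), (0, 2), (0, 3), (1, 2), (1, 3), (2, 3)}"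
    using assms less4_pairs by blast
  have "alternating r1 4 (\<lambda>xs. w121 (xs @ [x]) [i,j] c t u)" if "x < r1" for x
    using alternating_map_append[of r1 4 "[x]" "\<lambda>xs. w121 xs [i,j] c t u" id r1]
      w121_props(1)[OF r3, of c t u i j] lt4(5) assms that by simp
  note p = alternating4_perm[OF this lt4(1-4), simplified]
  have A: "(\<Sum>x<r1. a2 $$ (x, n) * w121 [0,1,2,3,x] [i,j] c t u)
      = s * (\<Sum>x<r1. a2 $$ (x, n) * w121 [i,j,k,l,x] [i,j] c t u)"
    if "\<And>x. x < r1 \<Longrightarrow> w121 [0,1,2,3,x] [i,j] c t u = s * w121 [i,j,k,l,x] [i,j] c t u" for k l s
    unfolding sum_distrib_left using that by (intro sum.cong) (simp_all add: mult.left_commute)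
  have C: "(\<Sum>x<r1. a2 $$ (x, n) * w121 [0,1,2,3,x] [i,j] c t u)
      = s * (a1 $$ (c, i) * w221 [j,i,k,l] j n t u + a1 $$ (c, j) * w221 [i,j,k,l] i n t u
        + w1 [i,j,k,l] c t * w2 [i,j] n u - w1 [i,j,k,l] c u * w2 [i,j] n t)"
    if "\<And>x. x < r1 \<Longrightarrow> w121 [0,1,2,3,x] [i,j] c t u = s * w121 [i,j,k,l,x] [i,j] c t u"
      "k < r1" "l < r1" for k l s
    using A[OF that(1)] a2_w121[OF w121[OF r3], of i j k l c n t u] that(2,3) assms lt4(5) by simp
  \<comment> \<open>In each case \<open>k\<close>, \<open>l\<close> complete \<open>i\<close>,
    \<open>j\<close> to 0, 1, 2, 3, and \<open>s\<close> is the sign of the permutation (i, j, k,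
    l).\<close>
  show ?thesis
    using ij
  proof (elim insertE)
    assume "(i, j) = (0, 1)"
    then show ?thesis
      using C[of 1 2 3] p assms lt4(1-4) by (simp add: w1_std w221_std)
  next
    assume "(i, j) = (0, 2)"
    then show ?thesis
      using C[of "-1" 1 3] p assms lt4(1-4) by (simp add: w1_std w221_std)
  next
    assume "(i, j) = (0, 3)"
    then show ?thesis
      using C[of 1 1 2] p assms lt4(1-4) by (simp add: w1_std w221_std)
  next
    assume "(i, j) = (1, 2)"
    then show ?thesis
      using C[of 1 0 3] p assms lt4(1-4) by (simp add: w1_std w221_std)
  next
    assume "(i, j) = (1, 3)"
    then show ?thesis
      using C[of "-1" 0 2] p assms lt4(1-4) by (simp add: w1_std w221_std)
  next
    assume "(i, j) = (2, 3)"
    then show ?thesis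
      using C[of 1 0 1] p assms lt4(1-4) by (simp add: w1_std w221_std)
  qed simp
qed

text \<open>Every index below 4 is already in the list of five, so truncating \<open>a2\<close>
  loses nothing and \<open>a2_w121_std\<close> is the whole condition.\<close>

lemma linked_w1_ggss:
  assumes "i < j" "j < 4" "c < 2" "n < r2" "t < u" "u < r3"
  shows "(\<Sum>k<r1 - 4. d3 $$ (n, k) * linked_w1 [t, u, r3 + i, r3 + j] c k) =
    d1 $$ (c, t) * linked_w3 [u, r3 + i, r3 + j] n - d1 $$ (c, u) * linked_w3 [t, r3 + i, r3 + j] n
    + d1 $$ (c, r3 + i) * linked_w3 [t, u, r3 + j] n - d1 $$ (c, r3 + j) * linked_w3 [t, u, r3 + i] n"
proof -
  have r3: "r3 = 2"
    using assms r3_le by linarith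
  have rep: "w121 [0,1,2,3,x] [i,j] c t u = 0" if "x < 4" for x
  proof -
    have "alternating r1 5 (\<lambda>xs. w121 xs [i,j] c t u)"
      using w121_props(1)[OF r3] assms lt4(5) by simp
    moreover have "\<not> distinct [0,1,2,3,x]" "set [0,1,2,3,x] \<subseteq> {..<r1}"
      using that lt4 less4[of x] by auto
    ultimately show ?thesis
      by (auto simp: alternating_def)
  qed
  have "(\<Sum>k<r1 - 4. d3 $$ (n, k) * linked_w1 [t, u, r3 + i, r3 + j] c k)
      = - (\<Sum>k<r1 - 4. a2 $$ (k + 4, n) * w121 [0,1,2,3,k + 4] [i,j] c t u)"
    unfolding sum_negf[symmetric]
    using assms by (intro sum.cong) (simp_all add: d3_entries linked_w1_eqs)
  also have "\<dots> = - (\<Sum>x<r1. a2 $$ (x, n) * w121 [0,1,2,3,x] [i,j] c t u)"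
    using sum_a2_from4[of n "\<lambda>x. w121 [0,1,2,3,x] [i,j] c t u"] by (simp add: rep)
  finally show ?thesis
    using assms a2_w121_std[OF r3, of i j c n t u]
    by (simp add: d1_entries linked_w3_eqs)
qed

text \<open>The right-hand side consists of the four terms k < 4 of a1 a2 = 0, the left-hand side of
  the others.\<close>

lemma linked_w1_ssss:
  assumes "c < 2" "n < r2"
  shows "(\<Sum>k<r1 - 4. d3 $$ (n, k) * linked_w1 [r3 + 0, r3 + 1, r3 + 2, r3 + 3] c k) =
    d1 $$ (c, r3 + 0) * linked_w3 [r3 + 1, r3 + 2, r3 + 3] n - d1 $$ (c, r3 + 1) * linked_w3 [r3 + 0, r3 + 2, r3 + 3] n
    + d1 $$ (c, r3 + 2) * linked_w3 [r3 + 0, r3 + 1, r3 + 3] n - d1 $$ (c, r3 + 3) * linked_w3 [r3 + 0, r3 + 1, r3 + 2] n"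
proof -
  have "(\<Sum>k<r1 - 4. d3 $$ (n, k) * linked_w1 [r3 + 0, r3 + 1, r3 + 2, r3 + 3] c k)
      = (\<Sum>k<r1 - 4. a2 $$ (k + 4, n) * a1 $$ (c, k + 4))"
    using assms linked_w1_eqs(1)[of 0 1 2 3 c] by (intro sum.cong) (simp_all add: d3_entries)
  moreover have "(\<Sum>k<r1. a2 $$ (k, n) * a1 $$ (c, k)) = 0"
    using a1_a2[OF assms] by (simp add: mult.commute)
  ultimately show ?thesis
    using assms linked_w3_eqs(1)[of 0 1 2 n] linked_w3_eqs(1)[of 0 1 3 n] linked_w3_eqs(1)[of 0 2 3 n]
      linked_w3_eqs(1)[of 1 2 3 n] d1_entries(2)[of c 0] d1_entries(2)[of c 1] d1_entries(2)[of c 2] d1_entries(2)[of c 3]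
      sum_a2_from4[of n "\<lambda>k. a1 $$ (c, k)"]
    by (simp add: mult.commute flip: One_nat_def)
qed

lemma is_w1_linked: "is_w1_1 d1 d3 linked_w3 linked_w1"
proof -
  have sorted: "(\<Sum>k<r1 - 4. d3 $$ (n, k) * linked_w1 [x, y, z, v] c k) =
      d1 $$ (c, x) * linked_w3 [y, z, v] n - d1 $$ (c, y) * linked_w3 [x, z, v] n
      + d1 $$ (c, z) * linked_w3 [x, y, v] n - d1 $$ (c, v) * linked_w3 [x, y, z] n"
    if lt: "x < y" "y < z" "z < v" "v < r3 + 4" and cn: "c < 2" "n < r2" for x y z v c n
  proof -
    consider "r3 \<le> x" | "x < r3" "r3 \<le> y" | "y < r3" "r3 \<le> z"
      using lt r3_le by linarith
    then show ?thesis
    proof cases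
      case 1
      then have "x = r3 + 0" "y = r3 + 1" "z = r3 + 2" "v = r3 + 3"
        using lt by linarith+
      then show ?thesis
        using linked_w1_ssss[OF cn] by (simp only:)
    next
      case 2
      then show ?thesis
        using linked_w1_gsss[of "y - r3" "z - r3" "v - r3" c n x] lt cn by simp
    next
      case 3
      then show ?thesis
        using linked_w1_ggss[of "z - r3" "v - r3" c n x y] lt cn by simp
    qed
  qed
  have "(\<Sum>k<r1 - 4. d3 $$ (n, k) * linked_w1 xs c k) =
      d1 $$ (c, xs ! 0) * linked_w3 [xs ! 1, xs ! 2, xs ! 3] n
      - d1 $$ (c, xs ! 1) * linked_w3 [xs ! 0, xs ! 2, xs ! 3] n
      + d1 $$ (c, xs ! 2) * linked_w3 [xs ! 0, xs ! 1, xs ! 3] n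
      - d1 $$ (c, xs ! 3) * linked_w3 [xs ! 0, xs ! 1, xs ! 2] n"
    if "length xs = 4" "set xs \<subseteq> {..<r3 + 4}" "c < 2" "n < r2" for xs c n
    using that(1,2)
  proof (rule alternating_eq_sorted[rotated 2])
    show "alternating (r3 + 4) 4 (\<lambda>xs. \<Sum>k<r1 - 4. d3 $$ (n, k) * linked_w1 xs c k)"
      by (rule alternating_sum) (rule linked_w1_alt)
    show "alternating (r3 + 4) 4 (\<lambda>xs. d1 $$ (c, xs ! 0) * linked_w3 [xs ! 1, xs ! 2, xs ! 3] n
      - d1 $$ (c, xs ! 1) * linked_w3 [xs ! 0, xs ! 2, xs ! 3] n
      + d1 $$ (c, xs ! 2) * linked_w3 [xs ! 0, xs ! 1, xs ! 3] n
      - d1 $$ (c, xs ! 3) * linked_w3 [xs ! 0, xs ! 1, xs ! 2] n)"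
      by (rule alternating_wedge) (rule linked_w3_alt)
  next
    fix ys :: "nat list"
    assume ys: "length ys = 4" "set ys \<subseteq> {..<r3 + 4}" "sorted_wrt (<) ys"
    then obtain x y z v where "ys = [x, y, z, v]" by (auto elim: length4E)
    with ys show "(\<Sum>k<r1 - 4. d3 $$ (n, k) * linked_w1 ys c k) =
      d1 $$ (c, ys ! 0) * linked_w3 [ys ! 1, ys ! 2, ys ! 3] n
      - d1 $$ (c, ys ! 1) * linked_w3 [ys ! 0, ys ! 2, ys ! 3] n
      + d1 $$ (c, ys ! 2) * linked_w3 [ys ! 0, ys ! 1, ys ! 3] n
      - d1 $$ (c, ys ! 3) * linked_w3 [ys ! 0, ys ! 1, ys ! 2] n"
      using sorted[of x y z v c n] that(3,4) by (simp add: numeral_3_eq_3)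
  qed
  from this[of "[_, _, _, _]"] show ?thesis
    by (simp add: is_w1_1_def Let_def d_dims linked_w1_alt numeral_3_eq_3)
qed

section \<open>The values for arbitrary orders of the arguments\<close>

lemma linked_w3_sss:
  assumes "i < j" "j < k" "{i, j, k, r} = {0, 1, 2, 3}"
  shows "linked_w3 [r3 + i, r3 + j, r3 + k] h = (- 1) ^ Suc r * a2 $$ (r, h)"
proof -
  have "i \<in> {0, 1, 2, 3}" "j \<in> {0, 1, 2, 3}" "k \<in> {0, 1, 2, 3}"
    unfolding assms(3)[symmetric] by simp_all
  moreover have "card {i, j, k, r} = 4"
    unfolding assms(3) by simp
  then have "r \<notin> {i, j, k}"
    using assms(1,2) by (auto simp: card_insert_if split: if_splits)
  moreover have "r \<in> {0, 1, 2, 3}"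
    unfolding assms(3)[symmetric] by simp
  ultimately have "r = 6 - (i + j + k)"
    using assms(1,2) by auto
  then show ?thesis
    using linked_w3_eqs(1)[OF assms(1,2)] by simp
qed

text \<open>Passing \<gamma>_t over two s's is an even permutation, so no sign appears; exchanging i
  and j changes the sign of both sides.\<close>

lemma linked_w3_ssg:
  assumes "i < 4" "j < 4" "i \<noteq> j" "t < r3" "h < r2"
  shows "linked_w3 [r3 + i, r3 + j, t] h = w2 [i,j] h t"
proof -
  have "linked_w3 [r3 + i, r3 + j, t] h = linked_w3 [t, r3 + i, r3 + j] h"
    "linked_w3 [t, r3 + i, r3 + j] h = - linked_w3 [t, r3 + j, r3 + i] h"
    using alternating3(4)[OF linked_w3_alt, of t "r3 + 4" "r3 + i" "r3 + j" h]
      alternating3(2)[OF linked_w3_alt, of t "r3 + 4" "r3 + j" "r3 + i" h] assms by simp_all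
  then show ?thesis
    using w2_perm[of h t j i] assms lt4(5) linked_w3_eqs(2)[of i j t h] linked_w3_eqs(2)[of j i t h]
    by (cases "i < j") simp_all
qed

lemma linked_w3_sgg:
  assumes "i < 4" "t < r3" "u < r3" "t \<noteq> u" "h < r2"
  shows "linked_w3 [r3 + i, t, u] h = w221 [0,1,2,3] i h t u"
proof -
  have "linked_w3 [r3 + i, t, u] h = linked_w3 [t, u, r3 + i] h"
    "linked_w3 [t, u, r3 + i] h = - linked_w3 [u, t, r3 + i] h"
    using alternating3(5)[OF linked_w3_alt, of t "r3 + 4" u "r3 + i" h]
      alternating3(1)[OF linked_w3_alt, of u "r3 + 4" t "r3 + i" h] assms by simp_all
  then show ?thesis
    using w221_std_skew[of i h u t] assms linked_w3_eqs(3)[of t u i h] linked_w3_eqs(3)[of u t i h]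
    by (cases "t < u") simp_all
qed

text \<open>Both sides are alternating in i, j, l, so increasing triples suffice. There the odd move
  of \<gamma>_t cancels the minus sign in \<open>linked_w1_sorted\<close>.\<close>

lemma linked_w1_sssg:
  assumes "i < 4" "j < 4" "l < 4" "distinct [i, j, l]" "t < r3" "c < 2" "4 \<le> k" "k < r1"
  shows "linked_w1 [r3 + i, r3 + j, r3 + l, t] c (k - 4) = w1 [i,j,l,k] c t"
proof -
  \<comment> \<open>Both sides are put in the shape of \<open>alternating_map_append\<close>, with
    \<open>id\<close> as the renumbering on the right.\<close>
  have "linked_w1 (map ((+) r3) [i, j, l] @ [t]) c (k - 4) = w1 (map id [i, j, l] @ [k]) c t"
  proof (rule alternating_eq_sorted[where n = 4 and p = 3 and xs = "[i, j, l]"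
        and w = "\<lambda>xs. linked_w1 (map ((+) r3) xs @ [t]) c (k - 4)" and w' = "\<lambda>xs. w1 (map id xs @ [k]) c t"])
    show "alternating 4 3 (\<lambda>xs. linked_w1 (map ((+) r3) xs @ [t]) c (k - 4))"
      by (rule alternating_map_append[where N = "r3 + 4"]) (use assms linked_w1_alt in auto)
    show "alternating 4 3 (\<lambda>xs. w1 (map id xs @ [k]) c t)"
      by (rule alternating_map_append[where N = r1]) (use assms w1_alt r1_ge in auto)
  next
    fix ys :: "nat list"
    assume ys: "length ys = 3" "set ys \<subseteq> {..<4}" "sorted_wrt (<) ys"
    then obtain a b d where abd: "ys = [a, b, d]" by (auto elim: length3E)
    then have "linked_w1 [r3 + a, r3 + b, r3 + d, t] c (k - 4) = - linked_w1 [t, r3 + a, r3 + b, r3 + d] c (k - 4)"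
      using alternating4_perm(12)[OF linked_w1_alt, of t "r3 + 4" "r3 + a" "r3 + b" "r3 + d" c "k - 4"] assms ys
      by simp
    then show "linked_w1 (map ((+) r3) ys @ [t]) c (k - 4) = w1 (map id ys @ [k]) c t"
      using abd ys assms linked_w1_eqs(2)[of a b d t c "k - 4"] by simp
  qed (use assms in auto)
  then show ?thesis by simp
qed

text \<open>Passing two \<gamma>'s over two s's is even. Both sides change sign when i, j or t, u
  are exchanged, which leaves the case i < j, t < u.\<close>

lemma linked_w1_ssgg:
  assumes "i < 4" "j < 4" "i \<noteq> j" "t < r3" "u < r3" "t \<noteq> u" "c < 2" "4 \<le> k" "k < r1"
  shows "linked_w1 [r3 + i, r3 + j, t, u] c (k - 4) = w121 [0,1,2,3,k] [i,j] c t u"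
proof -
  have r3: "r3 = 2"
    using assms r3_le by linarith
  have sorted: "linked_w1 [r3 + i, r3 + j, t, u] c (k - 4) = w121 [0,1,2,3,k] [i,j] c t u"
    if "i < j" "t < u" "j < 4" "u < r3" for i j t u
    using alternating4_perm(8)[OF linked_w1_alt, of t "r3 + 4" u "r3 + i" "r3 + j" c "k - 4"]
      linked_w1_eqs(3)[of i j t u c "k - 4"] that assms by simp
  have L: "linked_w1 [r3 + i, r3 + j, t, u] c (k - 4) = - linked_w1 [r3 + j, r3 + i, t, u] c (k - 4)"
    "linked_w1 [r3 + i, r3 + j, t, u] c (k - 4) = - linked_w1 [r3 + i, r3 + j, u, t] c (k - 4)"
    if "i < 4" "j < 4" "t < r3" "u < r3" for i j t u
    using alternating4_swap[OF linked_w1_alt, of "r3 + j" "r3 + 4" "r3 + i" t u c "k - 4"]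
      alternating4_swap[OF linked_w1_alt, of "r3 + i" "r3 + 4" "r3 + j" u t c "k - 4"] that by simp_all
  have R: "w121 [0,1,2,3,k] [i,j] c t u = - w121 [0,1,2,3,k] [j,i] c t u"
    "w121 [0,1,2,3,k] [i,j] c t u = - w121 [0,1,2,3,k] [i,j] c u t"
    if "i < 4" "j < 4" "t < r3" "u < r3" for i j t u
  proof -
    show "w121 [0,1,2,3,k] [i,j] c t u = - w121 [0,1,2,3,k] [j,i] c t u"
      using alternating2[OF w121_props(2)[OF r3], of 0 1 2 3 k c t u j i] lt4 assms that by simp
    show "w121 [0,1,2,3,k] [i,j] c t u = - w121 [0,1,2,3,k] [i,j] c u t"
      using w121_props(3)[OF r3, of 0 1 2 3 k i j c] lt4 assms that unfolding skew_def by blast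
  qed
  have half: "linked_w1 [r3 + i, r3 + j, t, u] c (k - 4) = w121 [0,1,2,3,k] [i,j] c t u"
    if "i < j" "j < 4" for i j
  proof (cases "t < u")
    case True
    with that assms show ?thesis by (simp add: sorted)
  next
    case False
    with that assms show ?thesis
      using L(2)[of i j t u] R(2)[of i j t u] sorted[of i j u t] by simp
  qed
  show ?thesis
  proof (cases "i < j")
    case True
    with assms show ?thesis by (simp add: half)
  next
    case False
    with assms show ?thesis
      using L(1)[of i j t u] R(1)[of i j t u] half[of j i] by simp
  qed
qed

end

subsection \<open>Free resolutions\<close>

lemma index_mult_mat_vec_sum:
  "A \<in> carrier_mat r n \<Longrightarrow> v \<in> carrier_vec n \<Longrightarrow> i < r \<Longrightarrow> (A *\<^sub>v v) $ i = (\<Sum>k<n. A $$ (i, k) * v $ k)"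
  by (auto simp: scalar_prod_def lessThan_atLeast0)

lemma mat_image_column:
  fixes A :: "'a::comm_ring_1 mat"
  assumes "A \<in> carrier_mat r n" "j < n"
  shows "col A j \<in> mat_image A"
proof -
  have "A *\<^sub>v unit_vec n j = col A j"
    using assms by (intro eq_vecI) auto
  moreover have "A *\<^sub>v unit_vec n j \<in> mat_image A"
    using assms by (auto simp: mat_image_def)
  ultimately show ?thesis by simp
qed

lemma kernel_eq_image_sum:
  fixes A B :: "'a::comm_ring_1 mat"
  assumes "A \<in> carrier_mat r n" "B \<in> carrier_mat n p" "mat_kernel A = mat_image B" "i < r" "j < p"
  shows "(\<Sum>k<n. A $$ (i, k) * B $$ (k, j)) = 0"
proof -
  have "col B j \<in> mat_kernel A"
    using mat_image_column assms by auto
  then have "(A *\<^sub>v col B j) $ i = 0"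
    using assms by (auto simp: mat_kernel_def)
  then show ?thesis
    using assms index_mult_mat_vec_sum[of A r n "col B j" i] by simp
qed

lemma kernel_zero_sum:
  fixes A :: "'a::comm_ring_1 mat"
  assumes "A \<in> carrier_mat r n" "mat_kernel A = {0\<^sub>v n}" "\<And>i. i < r \<Longrightarrow> (\<Sum>k<n. A $$ (i, k) * x k) = 0" "k < n"
  shows "x k = 0"
proof -
  have "A *\<^sub>v vec n x = 0\<^sub>v r"
    using assms index_mult_mat_vec_sum[of A r n "vec n x"] by (intro eq_vecI) auto
  then have "vec n x \<in> mat_kernel A"
    using assms by (auto simp: mat_kernel_def)
  then have "vec n x $ k = 0"
    using assms by auto
  then show ?thesis using assms by simp
qed

theorem theorem3p7:
  fixes G :: "nat \<Rightarrow> 'a::comm_ring_1 set" and m :: "'a set"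
    and M :: "('a, 'b) module" and \<eta> :: "'a vec \<Rightarrow> 'b"
    and r1 r2 r3 :: nat and a1 a2 a3 :: "'a mat"
    and w3 :: "nat list \<Rightarrow> nat \<Rightarrow> 'a"
    and w2 w1 :: "nat list \<Rightarrow> nat \<Rightarrow> nat \<Rightarrow> 'a"
    and w321 :: "nat list \<Rightarrow> nat \<Rightarrow> nat \<Rightarrow> nat \<Rightarrow> 'a"
    and w221 :: "nat list \<Rightarrow> nat \<Rightarrow> nat \<Rightarrow> nat \<Rightarrow> nat \<Rightarrow> 'a"
    and w121 :: "nat list \<Rightarrow> nat list \<Rightarrow> nat \<Rightarrow> nat \<Rightarrow> nat \<Rightarrow> 'a"
  defines "R \<equiv> class_ring :: 'a ring"
  assumes "graded_local G m" and "gorenstein_ring R"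
    and "infinite (carrier (R Quot m))" and "(2::'a) dvd 1"
    and "(r1, r2, r3) \<in> {(6, 5, 1), (5, 5, 2)}"
    and "perfect_module M"
    and "minimal_free_resolution G m (2, r1, r2, r3) a1 a2 a3 \<eta> M"
    and "ideal_height R (Idl\<^bsub>R\<^esub> {minor a1 i j | i j. i < 4 \<and> j < 4}) = 3"
    and "is_w3_1 a1 a2 w3"
    and "is_w2_1 a1 a2 a3 w3 w2"
    and "is_w1_1 a1 a3 w3 w1"
    and "is_w3_21 a1 a3 w3 w321"
    and "is_w2_21 a1 a2 a3 w3 w2 w1 w321 w221"
    and "r1 = 5 \<Longrightarrow> is_w1_21 a1 a3 w3 w1 w321 w121"
  defines "d1 \<equiv> linked_d1 a1 a3 w1" and "d2 \<equiv> linked_d2 a3 w3" and "d3 \<equiv> linked_d3 a2"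
    and "s \<equiv> \<lambda>i. r3 + i" and "\<gamma> \<equiv> \<lambda>t::nat. t" and "\<epsilon> \<equiv> \<lambda>k. k - 4"
  shows "\<exists>v3 v1. is_w3_1 d1 d2 v3 \<and> is_w1_1 d1 d3 v3 v1 \<and>
    (\<forall>i j k r h. i < j \<and> j < k \<and> {i, j, k, r} = {0, 1, 2, 3} \<and> h < r2 \<longrightarrow>
       v3 [s i, s j, s k] h = (-1) ^ Suc r * a2 $$ (r, h)) \<and>
    (\<forall>i<4. \<forall>j<4. \<forall>t<r3. \<forall>h<r2. i \<noteq> j \<longrightarrow>
       v3 [s i, s j, \<gamma> t] h = w2 [i, j] h t) \<and>
    (\<forall>i<4. \<forall>t<r3. \<forall>u<r3. \<forall>h<r2. t \<noteq> u \<longrightarrow>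
       v3 [s i, \<gamma> t, \<gamma> u] h = w221 [0, 1, 2, 3] i h t u) \<and>
    (\<forall>i<4. \<forall>j<4. \<forall>l<4. \<forall>t<r3. \<forall>c<2. \<forall>k\<in>{4..<r1}. distinct [i, j, l] \<longrightarrow>
       v1 [s i, s j, s l, \<gamma> t] c (\<epsilon> k) = w1 [i, j, l, k] c t) \<and>
    (\<forall>i<4. \<forall>j<4. \<forall>t<r3. \<forall>u<r3. \<forall>c<2. \<forall>k\<in>{4..<r1}. i \<noteq> j \<and> t \<noteq> u \<longrightarrow>
       v1 [s i, s j, \<gamma> t, \<gamma> u] c (\<epsilon> k) = w121 [0, 1, 2, 3, k] [i, j] c t u)"
proof -
  have res: "a1 \<in> carrier_mat 2 r1" "a2 \<in> carrier_mat r1 r2" "a3 \<in> carrier_mat r2 r3"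
      "mat_kernel a1 = mat_image a2" "mat_kernel a2 = mat_image a3" "mat_kernel a3 = {0\<^sub>v r3}"
    using assms(8) by (simp_all add: minimal_free_resolution_def free_resolution_def)
  interpret linked_structure_maps r1 r2 r3 a1 a2 a3 w3 w2 w1 w321 w221 w121
  proof
    show "4 \<le> r1" "r3 \<le> 2"
      using assms(6) by auto
    \<comment> \<open>Of the two formats only (2,5,5,2) has \<open>r3 = 2\<close>, and there
      \<open>r1 = 5\<close>.\<close>
    show "is_w1_21 a1 a3 w3 w1 w321 w121" if "r3 = 2"
      using assms(6,15) that by auto
  qed (use res assms(10-14) in \<open>auto intro: kernel_eq_image_sum kernel_zero_sum\<close>)
  have "\<forall>i j k r h. i < j \<and> j < k \<and> {i, j, k, r} = {0, 1, 2, 3} \<and> h < r2 \<longrightarrow>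
      linked_w3 [r3 + i, r3 + j, r3 + k] h = (-1) ^ Suc r * a2 $$ (r, h)"
    using linked_w3_sss by blast
  then show ?thesis
    unfolding d1_def d2_def d3_def s_def \<gamma>_def \<epsilon>_def
    by (intro exI[of _ linked_w3] exI[of _ linked_w1])
      (simp add: is_w3_linked is_w1_linked linked_w3_ssg linked_w3_sgg linked_w1_sssg linked_w1_ssgg)
qed

end
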